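(* There exists a polynomial-time algorithm that, given a bipartite graph $G$ with adjacency matrix $A_G$, decides whether there is a symmetric signing $s$ such that $A_G(s)$ is singular, and if so, finds such a signing.
   Context: For a real symmetric $n\times n$ matrix $M$, a signing is an $n\times n$ matrix $s$ with entries in $\{\pm1\}$; it is symmetric if $s$ is a symmetric matrix. The signed matrix $M(s)$ is the entry-wise product of $M$ and $s$. *)

theory Defs
  imports
    Complex_Main
    "HOL-Library.Log_Nat"
    "HOL-Computational_Algebra.Polynomial"
    "Jordan_Normal_Form.Matrix"
begin

text \<open>
  Algorithms are programs of the random access machine of Cook and Reckhow (Time bounded random
  access machines, 1973), charged by the logarithmic cost criterion. Its time is polynomially
  related to that of multitape Turing machines. The machine has integer registers indexed by the
  natural numbers, a one-way input tape and a one-way output tape of integers.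
\<close>

datatype instr =
    SetConst nat int     \<comment> \<open>\<open>X\<^sub>i \<leftarrow> c\<close>\<close>
  | Add nat nat nat      \<comment> \<open>\<open>X\<^sub>i \<leftarrow> X\<^sub>j + X\<^sub>k\<close>\<close>
  | Sub nat nat nat      \<comment> \<open>\<open>X\<^sub>i \<leftarrow> X\<^sub>j - X\<^sub>k\<close>\<close>
  | Load nat nat         \<comment> \<open>\<open>X\<^sub>i \<leftarrow> X\<^bsub>X\<^sub>j\<^esub>\<close>\<close>
  | Store nat nat        \<comment> \<open>\<open>X\<^bsub>X\<^sub>i\<^esub> \<leftarrow> X\<^sub>j\<close>\<close>
  | JumpPos nat nat      \<comment> \<open>transfer control to instruction \<open>m\<close> if \<open>X\<^sub>j > 0\<close>\<close>
  | Read nat             \<comment> \<open>next input integer to \<open>X\<^sub>i\<close>\<close>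
  | Print nat            \<comment> \<open>append \<open>X\<^sub>i\<close> to the output\<close>

type_synonym program = "instr list"

record config =
  pc :: nat
  reg :: "nat \<Rightarrow> int"
  inp :: "int list"
  outp :: "int list"

text \<open>
  \<open>None\<close> signals a crash, namely an indirect access to a negative address. Reading from an
  exhausted input tape yields 0.
\<close>

fun exec_instr :: "instr \<Rightarrow> config \<Rightarrow> config option" where
  "exec_instr (SetConst i c) \<sigma> =
     Some (\<sigma>\<lparr>pc := pc \<sigma> + 1, reg := (reg \<sigma>)(i := c)\<rparr>)"
| "exec_instr (Add i j k) \<sigma> =
     Some (\<sigma>\<lparr>pc := pc \<sigma> + 1, reg := (reg \<sigma>)(i := reg \<sigma> j + reg \<sigma> k)\<rparr>)"
| "exec_instr (Sub i j k) \<sigma> =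
     Some (\<sigma>\<lparr>pc := pc \<sigma> + 1, reg := (reg \<sigma>)(i := reg \<sigma> j - reg \<sigma> k)\<rparr>)"
| "exec_instr (Load i j) \<sigma> =
     (if reg \<sigma> j < 0 then None
      else Some (\<sigma>\<lparr>pc := pc \<sigma> + 1, reg := (reg \<sigma>)(i := reg \<sigma> (nat (reg \<sigma> j)))\<rparr>))"
| "exec_instr (Store i j) \<sigma> =
     (if reg \<sigma> i < 0 then None
      else Some (\<sigma>\<lparr>pc := pc \<sigma> + 1, reg := (reg \<sigma>)(nat (reg \<sigma> i) := reg \<sigma> j)\<rparr>))"
| "exec_instr (JumpPos m j) \<sigma> =
     Some (\<sigma>\<lparr>pc := (if reg \<sigma> j > 0 then m else pc \<sigma> + 1)\<rparr>)"
| "exec_instr (Read i) \<sigma> =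
     Some (\<sigma>\<lparr>pc := pc \<sigma> + 1,
             reg := (reg \<sigma>)(i := (case inp \<sigma> of [] \<Rightarrow> 0 | x # _ \<Rightarrow> x)),
             inp := tl (inp \<sigma>)\<rparr>)"
| "exec_instr (Print i) \<sigma> =
     Some (\<sigma>\<lparr>pc := pc \<sigma> + 1, outp := outp \<sigma> @ [reg \<sigma> i]\<rparr>)"

definition int_size :: "int \<Rightarrow> nat" where
  "int_size z = max 1 (floorlog 2 (nat \<bar>z\<bar>))"

fun instr_cost :: "instr \<Rightarrow> config \<Rightarrow> nat" where
  "instr_cost (SetConst i c) \<sigma> = int_size c"
| "instr_cost (Add i j k) \<sigma> = int_size (reg \<sigma> j) + int_size (reg \<sigma> k)"
| "instr_cost (Sub i j k) \<sigma> = int_size (reg \<sigma> j) + int_size (reg \<sigma> k)"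
| "instr_cost (Load i j) \<sigma> = int_size (reg \<sigma> j) + int_size (reg \<sigma> (nat (reg \<sigma> j)))"
| "instr_cost (Store i j) \<sigma> = int_size (reg \<sigma> i) + int_size (reg \<sigma> j)"
| "instr_cost (JumpPos m j) \<sigma> = int_size (reg \<sigma> j)"
| "instr_cost (Read i) \<sigma> = int_size (case inp \<sigma> of [] \<Rightarrow> 0 | x # _ \<Rightarrow> x)"
| "instr_cost (Print i) \<sigma> = int_size (reg \<sigma> i)"

inductive run :: "program \<Rightarrow> config \<Rightarrow> nat \<Rightarrow> config \<Rightarrow> bool" for P :: program where
  run_refl: "run P \<sigma> 0 \<sigma>"
| run_step: "\<lbrakk>pc \<sigma> < length P; exec_instr (P ! pc \<sigma>) \<sigma> = Some \<sigma>'; run P \<sigma>' t \<sigma>''\<rbrakk>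
    \<Longrightarrow> run P \<sigma> (instr_cost (P ! pc \<sigma>) \<sigma> + t) \<sigma>''"

definition init_config :: "int list \<Rightarrow> config" where
  "init_config xs = \<lparr>pc = 0, reg = (\<lambda>_. 0), inp = xs, outp = []\<rparr>"

text \<open>The machine halts when control leaves the program.\<close>

definition outputs_in_time :: "program \<Rightarrow> int list \<Rightarrow> int list \<Rightarrow> nat \<Rightarrow> bool" where
  "outputs_in_time P xs ys b \<longleftrightarrow>
     (\<exists>t \<sigma>. run P (init_config xs) t \<sigma> \<and> length P \<le> pc \<sigma> \<and> outp \<sigma> = ys \<and> t \<le> b)"

definition input_size :: "int list \<Rightarrow> nat" where
  "input_size xs = (\<Sum>x\<leftarrow>xs. int_size x)"


text \<open>
  A graph is a finite simple undirected graph with vertex set \<open>{0..<n}\<close>; its edges are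
  two-element sets of vertices.
\<close>

definition simple_graph :: "nat \<Rightarrow> nat set set \<Rightarrow> bool" where
  "simple_graph n E \<longleftrightarrow> (\<forall>e\<in>E. e \<subseteq> {0..<n} \<and> card e = 2)"

definition bipartite_graph :: "nat \<Rightarrow> nat set set \<Rightarrow> bool" where
  "bipartite_graph n E \<longleftrightarrow> simple_graph n E \<and>
     (\<exists>X Y. X \<union> Y = {0..<n} \<and> X \<inter> Y = {} \<and> (\<forall>e\<in>E. \<exists>x\<in>X. \<exists>y\<in>Y. e = {x, y}))"

definition adj_mat :: "nat \<Rightarrow> nat set set \<Rightarrow> 'a::{zero,one} mat" where
  "adj_mat n E = mat n n (\<lambda>(i, j). if {i, j} \<in> E then 1 else 0)"

definition signing :: "nat \<Rightarrow> int mat \<Rightarrow> bool" where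
  "signing n s \<longleftrightarrow> s \<in> carrier_mat n n \<and> (\<forall>i<n. \<forall>j<n. s $$ (i, j) \<in> {1, -1})"

definition symmetric_signing :: "nat \<Rightarrow> int mat \<Rightarrow> bool" where
  "symmetric_signing n s \<longleftrightarrow> signing n s \<and> transpose_mat s = s"

definition signed_mat :: "real mat \<Rightarrow> int mat \<Rightarrow> real mat" where
  "signed_mat M s =
     mat (dim_row M) (dim_col M) (\<lambda>(i, j). M $$ (i, j) * real_of_int (s $$ (i, j)))"

definition singular_mat :: "real mat \<Rightarrow> bool" where
  "singular_mat M \<longleftrightarrow> square_mat M \<and> \<not> invertible_mat M"

definition singular_signing :: "nat \<Rightarrow> nat set set \<Rightarrow> int mat \<Rightarrow> bool" where
  "singular_signing n E s \<longleftrightarrow>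
     symmetric_signing n s \<and> singular_mat (signed_mat (adj_mat n E) s)"

text \<open>Matrices are written on the tapes entry by entry, in row-major order.\<close>

definition encode_mat :: "int mat \<Rightarrow> int list" where
  "encode_mat M = concat (mat_to_list M)"

definition encode_graph :: "nat \<Rightarrow> nat set set \<Rightarrow> int list" where
  "encode_graph n E = int n # encode_mat (adj_mat n E)"

end

theory Submission
  imports
    "Jordan_Normal_Form.Determinant"
    "HOL-Library.Nat_Bijection"
    Defs
begin

text \<open>
  A signing changes no entry modulo 2, so if the adjacency matrix is nonsingular over the field with
  two elements, then every signed matrix has odd determinant. Conversely, suppose that some nonempty
  set of rows sums to zero modulo 2 and lies on one side of the bipartition. Every vertex then has
  an even number of neighbours in the set; giving the edges to these neighbours alternating signs
  makes the rows of the set sum to zero over the reals, and the signing is symmetric because no edge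
  joins two vertices of the set. Gaussian elimination modulo 2 finds such a set: it adds two rows
  only when they share a column, hence never mixes the two sides.
\<close>

subsection \<open>Singularity modulo two\<close>

text \<open>In the nonsingular case no determinant is reduced modulo 2. If a signed matrix is
  singular, it has a nonzero integer kernel vector; back substitution modulo 2 shows that all
  entries of any integer kernel vector are even, and halving then gives an endless descent. So
  elimination has to deliver only rows with pivots, together with the set of original rows behind
  each of them. These sets serve both outcomes: they certify that the reduced rows are combinations
  of the original ones, and when a row vanishes, its set is the vertex set that carries the
  alternating signs. The other obstacle is the logarithmic cost of the machine. Elimination over two
  elements keeps entries at 0 and 1, so the largest integers that occur are cell addresses, which
  are quadratic in \<open>n\<close>. Each operand can therefore be charged its magnitude instead of
  its length, and the time remains polynomial. A compiler verified once for a small language yields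
  correctness and running time together.\<close>

text \<open>Counts are handled as sums of truth values throughout; these rules would rewrite them
  into cardinalities or sums over intersections.\<close>

declare sum_of_bool_eq [simp del] sum_mult_of_bool_eq [simp del] sum_of_bool_mult_eq [simp del]

text \<open>Here \<open>d\<close> is the set of original rows whose sum modulo 2 is
  \<open>t\<close>. Recording one side for the rows in \<open>d\<close> and the opposite one for the
  columns in \<open>t\<close> lets a single shared column show that two combinations come from the
  same side.\<close>

definition consistent_row ::
    "nat \<Rightarrow> (nat \<Rightarrow> nat \<Rightarrow> bool) \<Rightarrow> nat set \<Rightarrow> (nat \<Rightarrow> bool) \<Rightarrow> (nat \<Rightarrow> bool) \<Rightarrow> bool" where
  "consistent_row n a X t d \<longleftrightarrow>
     (\<exists>b. (\<forall>i<n. d i \<longrightarrow> (i \<in> X) = b) \<and> (\<forall>j<n. t j \<longrightarrow> (j \<in> X) \<noteq> b)) \<and>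
     (\<forall>j<n. t j = odd (\<Sum>i<n. of_bool (d i \<and> a i j) :: nat))"

lemma odd_sum_xor:
  "odd (\<Sum>i<(n::nat). of_bool ((d i \<noteq> e i) \<and> f i) :: nat) \<longleftrightarrow>
    odd (\<Sum>i<n. of_bool (d i \<and> f i) :: nat) \<noteq> odd (\<Sum>i<n. of_bool (e i \<and> f i) :: nat)"
  by (induction n) auto

lemma consistent_row_single:
  assumes "r < n" "\<And>i j. i < n \<Longrightarrow> j < n \<Longrightarrow> a i j \<Longrightarrow> (i \<in> X) \<noteq> (j \<in> X)"
  shows "consistent_row n a X (a r) (\<lambda>i. i = r)"
proof -
  have "(\<Sum>i<n. of_bool (i = r \<and> a i j) :: nat) = of_bool (a r j)" for j
  proof -
    have "(\<Sum>i<n. of_bool (i = r \<and> a i j) :: nat) = (\<Sum>i<n. if i = r then of_bool (a r j) else 0)"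
      by (intro sum.cong) auto
    then show ?thesis using assms by simp
  qed
  then show ?thesis unfolding consistent_row_def using assms by auto
qed

text \<open>
  If the reduced rows share a column, then they come from the same side of the bipartition, so that
  elimination never mixes the two sides.
\<close>

lemma consistent_row_xor:
  assumes "consistent_row n a X t d" "consistent_row n a X w c" "p < n" "t p" "w p"
  shows "consistent_row n a X (\<lambda>j. t j \<noteq> w j) (\<lambda>i. d i \<noteq> c i)"
proof -
  obtain b where b: "\<forall>i<n. d i \<longrightarrow> (i \<in> X) = b" "\<forall>j<n. t j \<longrightarrow> (j \<in> X) \<noteq> b"
    using assms(1) unfolding consistent_row_def by blast
  obtain b' where b': "\<forall>i<n. c i \<longrightarrow> (i \<in> X) = b'" "\<forall>j<n. w j \<longrightarrow> (j \<in> X) \<noteq> b'"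
    using assms(2) unfolding consistent_row_def by blast
  have "b = b'" using b(2) b'(2) assms(3-5) by metis
  have "(i \<in> X) = b" if "i < n" "d i \<noteq> c i" for i
    using b(1) b'(1) that \<open>b = b'\<close> by (cases "d i") auto
  moreover have "(j \<in> X) \<noteq> b" if "j < n" "t j \<noteq> w j" for j
    using b(2) b'(2) that \<open>b = b'\<close> by (cases "t j") auto
  ultimately have "\<exists>b. (\<forall>i<n. d i \<noteq> c i \<longrightarrow> (i \<in> X) = b) \<and> (\<forall>j<n. t j \<noteq> w j \<longrightarrow> (j \<in> X) \<noteq> b)"
    by (intro exI[of _ b]) auto
  moreover have "\<forall>j<n. (t j \<noteq> w j) = odd (\<Sum>i<n. of_bool ((d i \<noteq> c i) \<and> a i j) :: nat)"
    using assms(1,2) unfolding consistent_row_def odd_sum_xor by simp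
  ultimately show ?thesis unfolding consistent_row_def by (rule conjI)
qed

text \<open>Rows and sets are read off unbounded arrays, about which the program guarantees
  something only below \<open>n\<close>.\<close>

lemma consistent_row_cong:
  assumes "consistent_row n a X t d" "\<And>j. j < n \<Longrightarrow> t' j = t j" "\<And>i. i < n \<Longrightarrow> d' i = d i"
  shows "consistent_row n a X t' d'"
proof -
  have sums: "(\<Sum>i<n. of_bool (d' i \<and> a i j) :: nat) = (\<Sum>i<n. of_bool (d i \<and> a i j))" for j
    using assms(3) by (intro sum.cong) auto
  obtain b where b: "\<forall>i<n. d i \<longrightarrow> (i \<in> X) = b" "\<forall>j<n. t j \<longrightarrow> (j \<in> X) \<noteq> b"
    using assms(1) unfolding consistent_row_def by metis
  have "\<exists>b. (\<forall>i<n. d' i \<longrightarrow> (i \<in> X) = b) \<and> (\<forall>j<n. t' j \<longrightarrow> (j \<in> X) \<noteq> b)"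
    using b assms(2,3) by (intro exI[of _ b]) simp
  moreover have "\<forall>j<n. t' j = odd (\<Sum>i<n. of_bool (d' i \<and> a i j) :: nat)"
    using assms(1,2) unfolding consistent_row_def sums by simp
  ultimately show ?thesis unfolding consistent_row_def by (rule conjI)
qed

section \<open>From a dependent set of rows to a singular signing\<close>

definition prefix_parity :: "(nat \<Rightarrow> nat \<Rightarrow> bool) \<Rightarrow> (nat \<Rightarrow> bool) \<Rightarrow> nat \<Rightarrow> nat \<Rightarrow> bool" where
  "prefix_parity a d i j \<longleftrightarrow> odd (\<Sum>k<j. of_bool (d k \<and> a i k) :: nat)"

text \<open>The endpoint of an edge outside \<open>d\<close> decides its sign: signs alternate along
  the neighbours of that endpoint in \<open>d\<close>. The second case mirrors the first to make the
  matrix symmetric; if \<open>d\<close> contains no edge, two indices in \<open>d\<close> get sign 1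
  in either order.\<close>

definition alternating_sign :: "(nat \<Rightarrow> nat \<Rightarrow> bool) \<Rightarrow> (nat \<Rightarrow> bool) \<Rightarrow> nat \<Rightarrow> nat \<Rightarrow> int" where
  "alternating_sign a d i j =
     (if d j then if prefix_parity a d i j then -1 else 1
      else if d i then if prefix_parity a d j i then -1 else 1 else 1)"

text \<open>The nonzero terms are 1, -1, 1, -1, and so on, hence partial sums are 0 or 1 and record
  the parity of the number of terms so far.\<close>

lemma alternating_sum:
  "(\<Sum>j<m. of_bool (a i j) * alternating_sign a d i j * of_bool (d j)) = of_bool (prefix_parity a d i m)"
  by (induction m) (auto simp: prefix_parity_def alternating_sign_def)

lemma singular_mat_if_kernel:
  assumes M: "M \<in> carrier_mat n n" and v: "v \<in> carrier_vec n" "v \<noteq> 0\<^sub>v n" "M *\<^sub>v v = 0\<^sub>v n"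
  shows "singular_mat M"
proof -
  have False if MB: "inverts_mat M B" and BM: "inverts_mat B M" for B
  proof -
    have "M * B = 1\<^sub>m n" "B * M = 1\<^sub>m (dim_row B)" "dim_col M = n"
      using MB BM M by (auto simp: inverts_mat_def)
    then have BM: "B * M = 1\<^sub>m n" and B: "B \<in> carrier_mat n n"
      by (metis index_mult_mat(3) index_one_mat(3),
          metis carrier_matI index_mult_mat(3) index_one_mat(3))
    have "v = 1\<^sub>m n *\<^sub>v v" using v by simp
    also have "\<dots> = B *\<^sub>v (M *\<^sub>v v)" using BM B M v by (metis assoc_mult_mat_vec)
    also have "\<dots> = 0\<^sub>v n" using v B by auto
    finally show False using v by simp
  qed
  then show ?thesis using M unfolding singular_mat_def invertible_mat_def by auto
qed

text \<open>The kernel vector is the indicator of \<open>d\<close>, nonzero because of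
  \<open>r\<close>. Each row sum of the signed matrix over \<open>d\<close> alternates an even
  number of times and vanishes.\<close>

lemma singular_signing_if_dependent:
  assumes "r < n" "d r" and cons: "consistent_row n a X (\<lambda>_. False) d"
    and bip: "\<And>i j. i < n \<Longrightarrow> j < n \<Longrightarrow> a i j \<Longrightarrow> (i \<in> X) \<noteq> (j \<in> X)"
    and a: "\<And>i j. a i j \<longleftrightarrow> {i, j} \<in> E"
  shows "singular_signing n E (mat n n (\<lambda>(i, j). alternating_sign a d i j))"
proof -
  let ?s = "mat n n (\<lambda>(i, j). alternating_sign a d i j)"
  have sym: "a i j = a j i" for i j by (simp add: a insert_commute)
  have ind: "\<not> a i j" if "d i" "d j" "i < n" "j < n" for i j
    using cons bip[of i j] that unfolding consistent_row_def by blast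
  \<comment> \<open>The hypothesis \<open>cons\<close> counts column \<open>i\<close> over the rows
    in \<open>d\<close>; by symmetry of \<open>a\<close> these are the neighbours of
    \<open>i\<close> in \<open>d\<close>.\<close>
  have even: "\<not> prefix_parity a d i n" if "i < n" for i
    using cons that unfolding consistent_row_def prefix_parity_def
    by (simp add: sym[of i])
  \<comment> \<open>This settles symmetry when both indices lie in \<open>d\<close>: no neighbour is
    counted, so both signs are 1.\<close>
  have "prefix_parity a d i j = False" if "d i" "i < n" "j < n" for i j
  proof -
    have z: "(\<Sum>k<j. of_bool (d k \<and> a i k) :: nat) = 0"
      using ind that by (intro sum.neutral) auto
    show ?thesis by (simp only: prefix_parity_def z even_zero not_True_eq_False)
  qed
  then have "alternating_sign a d i j = alternating_sign a d j i" if "i < n" "j < n" for i j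
    using that by (auto simp: alternating_sign_def)
  then have "symmetric_signing n ?s"
    unfolding symmetric_signing_def signing_def
    by (auto simp: alternating_sign_def intro!: eq_matI)
  moreover have "singular_mat (signed_mat (Defs.adj_mat n E) ?s)"
  proof (rule singular_mat_if_kernel)
    let ?v = "vec n (\<lambda>j. of_bool (d j)) :: real vec"
    have "?v $ r \<noteq> 0\<^sub>v n $ r" using assms(1,2) by simp
    then show "?v \<noteq> 0\<^sub>v n" by auto
    show "signed_mat (Defs.adj_mat n E) ?s *\<^sub>v ?v = 0\<^sub>v n"
    proof (rule eq_vecI)
      fix i assume "i < dim_vec (0\<^sub>v n :: real vec)"
      then have i: "i < n" by simp
      have "(signed_mat (Defs.adj_mat n E) ?s *\<^sub>v ?v) $ i =
        (\<Sum>j<n. of_bool (a i j) * real_of_int (alternating_sign a d i j) * of_bool (d j))"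
        using i by (simp add: signed_mat_def Defs.adj_mat_def scalar_prod_def lessThan_atLeast0)
          (rule sum.cong, simp_all add: a)
      also have "\<dots> = real_of_int (\<Sum>j<n. of_bool (a i j) * alternating_sign a d i j * of_bool (d j))"
        by simp
      also have "\<dots> = 0" unfolding alternating_sum using even[OF i] by simp
      finally show "(signed_mat (Defs.adj_mat n E) ?s *\<^sub>v ?v) $ i = 0\<^sub>v n $ i" using i by simp
    qed (simp add: signed_mat_def Defs.adj_mat_def)
  qed (auto simp: signed_mat_def Defs.adj_mat_def)
  ultimately show ?thesis by (simp add: singular_signing_def)
qed

section \<open>Triangular rows modulo 2 exclude singular signings\<close>

lemma singular_imp_det_0:
  assumes M: "(M :: real mat) \<in> carrier_mat n n" and "singular_mat M"
  shows "det M = 0"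
proof (rule ccontr)
  assume "det M \<noteq> 0"
  from det_non_zero_imp_unit[OF M this, of "()"]
  obtain B where "B \<in> carrier_mat n n" "B * M = 1\<^sub>m n" "M * B = 1\<^sub>m n"
    by (auto simp: Units_def ring_mat_def)
  then have "invertible_mat M"
    using M unfolding invertible_mat_def inverts_mat_def by auto
  then show False using assms by (simp add: singular_mat_def)
qed

text \<open>Back substitution modulo 2: a solution \<open>z\<close> of the original system also
  solves the combined rows \<open>w\<close>, which are triangular after permuting the columns by
  \<open>p\<close>.\<close>

lemma even_solution:
  fixes w c a :: "nat \<Rightarrow> nat \<Rightarrow> bool" and z :: "nat \<Rightarrow> int"
  assumes w: "\<And>k j. k < n \<Longrightarrow> j < n \<Longrightarrow> w k j = odd (\<Sum>i<n. of_bool (c k i \<and> a i j) :: nat)"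
    and p: "\<And>k. k < n \<Longrightarrow> p k < n" "\<And>k. k < n \<Longrightarrow> w k (p k)"
    and tri: "\<And>k k'. k < n \<Longrightarrow> k' < k \<Longrightarrow> \<not> w k (p k')"
    and z: "\<And>i. i < n \<Longrightarrow> even (\<Sum>j<n. of_bool (a i j) * z j)"
    and "j < n"
  shows "even (z j)"
proof -
  \<comment> \<open>Row \<open>k\<close> is nonzero at its own pivot but zero at all earlier
    ones.\<close>
  have "inj_on p {..<n}"
  proof (rule linorder_inj_onI)
    fix k' k assume "k' < k" "k' \<in> {..<n}" "k \<in> {..<n}"
    then show "p k' \<noteq> p k" using p tri by (metis lessThan_iff)
  qed auto
  then have onto: "p ` {..<n} = {..<n}"
    using p by (intro endo_inj_surj) auto
  have wz: "even (\<Sum>j<n. of_bool (w k j) * z j)" if k: "k < n" for k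
  proof -
    \<comment> \<open>The bit \<open>w k j\<close> and the number of summed entries in column
      \<open>j\<close> have the same parity, so the row can be exchanged for an integer combination
      of original rows.\<close>
    have "even (\<Sum>j<n. (of_bool (w k j) - (\<Sum>i<n. of_bool (c k i \<and> a i j))) * z j)"
    proof (rule dvd_sum)
      fix j assume "j \<in> {..<n}"
      then have "w k j = odd (\<Sum>i<n. of_bool (c k i \<and> a i j) :: nat)" using w k by simp
      also have "\<dots> = odd (int (\<Sum>i<n. of_bool (c k i \<and> a i j) :: nat))" by presburger
      also have "int (\<Sum>i<n. of_bool (c k i \<and> a i j) :: nat) = (\<Sum>i<n. of_bool (c k i \<and> a i j))"
        by simp
      finally show "even ((of_bool (w k j) - (\<Sum>i<n. of_bool (c k i \<and> a i j))) * z j)"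
        by simp
    qed
    moreover have "even (\<Sum>j<n. (\<Sum>i<n. of_bool (c k i \<and> a i j)) * z j)"
    proof -
      have "(\<Sum>j<n. (\<Sum>i<n. of_bool (c k i \<and> a i j)) * z j)
        = (\<Sum>j<n. \<Sum>i<n. of_bool (c k i) * (of_bool (a i j) * z j))"
        by (simp add: sum_distrib_right of_bool_conj mult.assoc)
      also have "\<dots> = (\<Sum>i<n. of_bool (c k i) * (\<Sum>j<n. of_bool (a i j) * z j))"
        by (subst sum.swap) (simp add: sum_distrib_left)
      also have "even \<dots>" using z by (intro dvd_sum) auto
      finally show ?thesis .
    qed
    ultimately show ?thesis
      by (simp add: left_diff_distrib sum_subtractf)
  qed
  \<comment> \<open>Downwards in \<open>k\<close>: every column other than \<open>p k\<close> is an
    earlier pivot, where row \<open>k\<close> vanishes, or a later pivot, where \<open>z\<close> is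
    even by induction.\<close>
  have "even (z (p k))" if "k < n" for k
    using that
  proof (induction "n - k" arbitrary: k rule: less_induct)
    case less
    have "even (of_bool (w k j) * z j)" if j: "j < n" "j \<noteq> p k" for j
    proof -
      have "j \<in> p ` {..<n}" using onto j(1) by simp
      then obtain k' where k': "k' < n" "j = p k'" by auto
      then consider "k' < k" | "k < k'" using j by (cases k' k rule: linorder_cases) auto
      then show ?thesis
      proof cases
        case 1
        then show ?thesis using tri less.prems k' by simp
      next
        case 2
        then show ?thesis using less.hyps[of k'] k' by simp
      qed
    qed
    then have "even (\<Sum>j\<in>{..<n} - {p k}. of_bool (w k j) * z j)"
      by (intro dvd_sum) auto
    moreover have "(\<Sum>j<n. of_bool (w k j) * z j) =
        of_bool (w k (p k)) * z (p k) + (\<Sum>j\<in>{..<n} - {p k}. of_bool (w k j) * z j)"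
      using p less.prems by (intro sum.remove) auto
    ultimately show ?case using wz[OF less.prems] p less.prems by simp
  qed
  moreover have "j \<in> p ` {..<n}" using onto \<open>j < n\<close> by simp
  ultimately show ?thesis by auto
qed

text \<open>Descent: half of a kernel vector with even entries is again an integer kernel vector,
  and the sum of absolute values drops unless the vector is zero.\<close>

lemma kernel_trivial_if_even:
  fixes M :: "int mat"
  assumes M: "M \<in> carrier_mat n n"
    and ev: "\<And>v j. v \<in> carrier_vec n \<Longrightarrow> M *\<^sub>v v = 0\<^sub>v n \<Longrightarrow> j < n \<Longrightarrow> even (v $ j)"
    and v: "v \<in> carrier_vec n" "M *\<^sub>v v = 0\<^sub>v n"
  shows "v = 0\<^sub>v n"
  using v
proof (induction "\<Sum>j<n. nat \<bar>v $ j\<bar>" arbitrary: v rule: less_induct)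
  case less
  define u where "u = vec n (\<lambda>j. v $ j div 2)"
  have u: "u \<in> carrier_vec n" by (simp add: u_def)
  have vu: "v = 2 \<cdot>\<^sub>v u"
    using less.prems ev[OF less.prems] by (intro eq_vecI) (auto simp: u_def)
  have "(M *\<^sub>v u) $ i = 0" if "i < n" for i
  proof -
    have "(M *\<^sub>v v) $ i = 2 * (M *\<^sub>v u) $ i"
      using that M u by (simp add: vu scalar_prod_def sum_distrib_left algebra_simps)
    then show ?thesis using less.prems that by simp
  qed
  then have Mu0: "M *\<^sub>v u = 0\<^sub>v n" using M by (intro eq_vecI) auto
  show ?case
  proof (cases "u = 0\<^sub>v n")
    case True
    then show ?thesis by (intro eq_vecI) (auto simp: vu)
  next
    case False
    then obtain j where j: "j < n" "u $ j \<noteq> 0" using u by (metis carrier_vecD eq_vecI index_zero_vec)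
    have "(\<Sum>j<n. nat \<bar>u $ j\<bar>) < (\<Sum>j<n. nat \<bar>v $ j\<bar>)"
      by (rule sum_strict_mono_ex1) (use j u in \<open>auto simp: vu intro!: bexI[of _ j]\<close>)
    from less.hyps[OF this u Mu0] False show ?thesis by simp
  qed
qed

text \<open>Signs are odd, so the signed kernel equation agrees with the unsigned one modulo 2; back
  substitution makes each integer kernel vector even, and descent makes it zero.\<close>

lemma no_singular_signing_if_triangular:
  fixes w c a :: "nat \<Rightarrow> nat \<Rightarrow> bool"
  assumes w: "\<And>k j. k < n \<Longrightarrow> j < n \<Longrightarrow> w k j = odd (\<Sum>i<n. of_bool (c k i \<and> a i j) :: nat)"
    and p: "\<And>k. k < n \<Longrightarrow> p k < n" "\<And>k. k < n \<Longrightarrow> w k (p k)"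
    and tri: "\<And>k k'. k < n \<Longrightarrow> k' < k \<Longrightarrow> \<not> w k (p k')"
    and a: "\<And>i j. a i j \<longleftrightarrow> {i, j} \<in> E"
  shows "\<not> singular_signing n E s"
proof
  assume s: "singular_signing n E s"
  define M where "M = mat n n (\<lambda>(i, j). of_bool (a i j) * s $$ (i, j))"
  have M: "M \<in> carrier_mat n n" by (simp add: M_def)
  have real_M: "signed_mat (Defs.adj_mat n E) s = map_mat real_of_int M"
    by (rule eq_matI) (auto simp: signed_mat_def Defs.adj_mat_def M_def a)
  have sg: "s $$ (i, j) \<in> {1, -1}" if "i < n" "j < n" for i j
    using s that by (auto simp: singular_signing_def symmetric_signing_def signing_def)
  have "det (map_mat real_of_int M) = 0"
    using s M singular_imp_det_0[of "map_mat real_of_int M" n]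
    by (simp add: singular_signing_def real_M)
  then have "det M = 0" by simp
  \<comment> \<open>The determinant criterion is applied over the integers, so the kernel vector is
    integral at once.\<close>
  then obtain v where v: "v \<in> carrier_vec n" "v \<noteq> 0\<^sub>v n" "M *\<^sub>v v = 0\<^sub>v n"
    using det_0_iff_vec_prod_zero[OF M] by auto
  moreover have "even (v $ j)" if v: "v \<in> carrier_vec n" "M *\<^sub>v v = 0\<^sub>v n" and "j < n" for v j
  proof (rule even_solution[where n = n and z = "\<lambda>j. v $ j" and w = w and c = c and a = a and p = p])
    fix i assume i: "i < n"
    have "(\<Sum>j<n. of_bool (a i j) * s $$ (i, j) * v $ j) = (M *\<^sub>v v) $ i"
      using i v(1) by (auto simp: M_def scalar_prod_def lessThan_atLeast0 intro!: sum.cong)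
    also have "\<dots> = 0" using v i by simp
    finally have "even (\<Sum>j<n. of_bool (a i j) * s $$ (i, j) * v $ j)" by simp
    \<comment> \<open>A sign is 1 or -1, so the two terms differ by 0 or by twice an entry of
      \<open>v\<close>.\<close>
    moreover have "even (\<Sum>j<n. of_bool (a i j) * s $$ (i, j) * v $ j - of_bool (a i j) * v $ j)"
      using sg i by (intro dvd_sum) force
    ultimately show "even (\<Sum>j<n. of_bool (a i j) * v $ j)"
      by (simp add: sum_subtractf)
  qed (use that w p tri in auto)
  ultimately show False using kernel_trivial_if_even[OF M] by blast
qed

section \<open>Timed runs and code fragments\<close>

definition run_within :: "program \<Rightarrow> config \<Rightarrow> nat \<Rightarrow> config \<Rightarrow> bool" where
  "run_within P \<sigma> b \<sigma>' \<longleftrightarrow> (\<exists>t\<le>b. run P \<sigma> t \<sigma>')"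

lemma run_trans: "run P \<sigma> t \<sigma>' \<Longrightarrow> run P \<sigma>' u \<sigma>'' \<Longrightarrow> run P \<sigma> (t + u) \<sigma>''"
proof (induction rule: run.induct)
  case (run_step \<sigma> \<sigma>' t \<sigma>'')
  then show ?case
    using run.run_step[of \<sigma> P \<sigma>' "t + u"] by (simp add: add.assoc)
qed simp

lemma run_within_refl: "run_within P \<sigma> b \<sigma>"
  unfolding run_within_def using run_refl by blast

lemma run_within_eq:
  "pc \<sigma> = pc \<sigma>' \<Longrightarrow> reg \<sigma> = reg \<sigma>' \<Longrightarrow> inp \<sigma> = inp \<sigma>' \<Longrightarrow> outp \<sigma> = outp \<sigma>' \<Longrightarrow>
    run_within P \<sigma> b \<sigma>'"
  using run_within_refl[of P \<sigma> b] by (metis (full_types) config.equality old.unit.exhaust)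

lemma run_within_trans:
  "run_within P \<sigma> b \<sigma>' \<Longrightarrow> run_within P \<sigma>' b' \<sigma>'' \<Longrightarrow> run_within P \<sigma> (b + b') \<sigma>''"
  unfolding run_within_def by (meson add_mono run_trans)

lemma run_within_mono: "run_within P \<sigma> b \<sigma>' \<Longrightarrow> b \<le> b' \<Longrightarrow> run_within P \<sigma> b' \<sigma>'"
  unfolding run_within_def by (meson order_trans)

lemma run_within_step:
  assumes "pc \<sigma> < length P" "P ! pc \<sigma> = ins" "exec_instr ins \<sigma> = Some \<sigma>'"
    and "instr_cost ins \<sigma> \<le> k" "run_within P \<sigma>' b \<sigma>''"
  shows "run_within P \<sigma> (k + b) \<sigma>''"
proof -
  obtain t where "t \<le> b" "run P \<sigma>' t \<sigma>''"
    using assms(5) by (auto simp: run_within_def)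
  then have "run P \<sigma> (instr_cost ins \<sigma> + t) \<sigma>''"
    using assms run_step[of \<sigma> P \<sigma>' t \<sigma>''] by simp
  then show ?thesis
    using \<open>t \<le> b\<close> assms(4) unfolding run_within_def by (meson add_mono)
qed

text \<open>Jump targets are absolute, so a compiled fragment has a meaning only at a fixed position
  of the whole program.\<close>

fun code_at :: "program \<Rightarrow> nat \<Rightarrow> program \<Rightarrow> bool" where
  "code_at P l [] \<longleftrightarrow> True"
| "code_at P l (x # xs) \<longleftrightarrow> l < length P \<and> P ! l = x \<and> code_at P (Suc l) xs"

lemma code_at_append: "code_at P l (xs @ ys) \<longleftrightarrow> code_at P l xs \<and> code_at P (l + length xs) ys"
  by (induction xs arbitrary: l) auto

lemma code_at_suffix: "code_at (pre @ xs) (length pre) xs"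
proof (induction xs arbitrary: pre)
  case (Cons x xs)
  from Cons[of "pre @ [x]"] show ?case by simp
qed simp

text \<open>A deliberately coarse bound: all values that occur are polynomial in \<open>n\<close>,
  so charging magnitude instead of length is affordable.\<close>

lemma int_size_le: "int_size z \<le> nat \<bar>z\<bar> + 1"
proof -
  have "floorlog 2 m \<le> m" for m
  proof (cases "m = 0")
    case False
    then have "2 ^ (floorlog 2 m - 1) \<le> m"
      using floorlog_bounds[of m 2] by simp
    moreover have "floorlog 2 m - 1 < 2 ^ (floorlog 2 m - 1)"
      by (rule less_exp)
    ultimately show ?thesis by linarith
  qed (simp add: floorlog_def)
  then show ?thesis by (simp add: int_size_def le_SucI)
qed

lemma int_size_bound: "\<bar>z\<bar> \<le> int u \<Longrightarrow> int_size z \<le> u + 1"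
  using int_size_le[of z] by linarith

lemma one_le_int_size: "1 \<le> int_size z"
  by (simp add: int_size_def)

subsection \<open>A loop language over arrays\<close>

text \<open>
  Index variables are immutable: they are bound by \<open>For\<close> (which runs over \<open>0, \<dots>, n - 1\<close>) and
  \<open>Let\<close>. Nothing is ever computed from an array entry, so no value exceeds \<open>n + 1\<close>, and a
  time bound can be read off the syntax.
\<close>

datatype com =
    Skip
  | Assign nat nat nat nat
  | AssignIdx nat nat nat nat
  | Input nat nat nat
  | Output int
  | Seq com com
  | IfPos nat nat nat com com
  | For nat com
  | Let nat nat nat nat com

record store =
  heap :: "nat \<Rightarrow> nat \<Rightarrow> nat \<Rightarrow> nat"
  hin :: "nat list"
  hout :: "int list"

definition put :: "nat \<Rightarrow> nat \<Rightarrow> nat \<Rightarrow> nat \<Rightarrow> store \<Rightarrow> store" where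
  "put a i j v s = s\<lparr>heap := (\<lambda>b k l. if b = a \<and> k = i \<and> l = j then v else heap s b k l)\<rparr>"

lemma put_simps [simp]:
  "heap (put a i j v s) b k l = (if b = a \<and> k = i \<and> l = j then v else heap s b k l)"
  "hin (put a i j v s) = hin s"
  "hout (put a i j v s) = hout s"
  by (simp_all add: put_def)

fun sem :: "nat \<Rightarrow> com \<Rightarrow> (nat \<Rightarrow> nat) \<Rightarrow> store \<Rightarrow> store" where
  "sem n Skip e s = s"
| "sem n (Assign a i j c) e s = put a (e i) (e j) c s"
| "sem n (AssignIdx a i j x) e s = put a (e i) (e j) (e x) s"
| "sem n (Input a i j) e s =
     (put a (e i) (e j) (case hin s of [] \<Rightarrow> 0 | x # _ \<Rightarrow> x) s)\<lparr>hin := tl (hin s)\<rparr>"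
| "sem n (Output c) e s = s\<lparr>hout := hout s @ [c]\<rparr>"
| "sem n (Seq c d) e s = sem n d e (sem n c e s)"
| "sem n (IfPos a i j c d) e s = (if heap s a (e i) (e j) > 0 then sem n c e s else sem n d e s)"
| "sem n (For x c) e s = fold (\<lambda>k. sem n c (e(x := k))) [0..<n] s"
| "sem n (Let x a i j c) e s = sem n c (e(x := heap s a (e i) (e j))) s"

text \<open>Bound variables must be fresh, as the compiler keeps each variable in one fixed register.\<close>

fun wf_com :: "nat set \<Rightarrow> com \<Rightarrow> bool" where
  "wf_com V Skip \<longleftrightarrow> True"
| "wf_com V (Assign a i j c) \<longleftrightarrow> a < 16 \<and> i \<in> V \<and> j \<in> V \<and> c \<le> 1"
| "wf_com V (AssignIdx a i j x) \<longleftrightarrow> a < 16 \<and> i \<in> V \<and> j \<in> V \<and> x \<in> V"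
| "wf_com V (Input a i j) \<longleftrightarrow> a < 16 \<and> i \<in> V \<and> j \<in> V"
| "wf_com V (Output c) \<longleftrightarrow> \<bar>c\<bar> \<le> 1"
| "wf_com V (Seq c d) \<longleftrightarrow> wf_com V c \<and> wf_com V d"
| "wf_com V (IfPos a i j c d) \<longleftrightarrow> a < 16 \<and> i \<in> V \<and> j \<in> V \<and> wf_com V c \<and> wf_com V d"
| "wf_com V (For x c) \<longleftrightarrow> x < 12 \<and> x \<notin> V \<and> wf_com (insert x V) c"
| "wf_com V (Let x a i j c) \<longleftrightarrow>
     a < 16 \<and> i \<in> V \<and> j \<in> V \<and> x < 12 \<and> x \<notin> V \<and> wf_com (insert x V) c"

subsection \<open>Compilation\<close>

text \<open>
  Register 0 holds the constant 1, register 1 holds \<open>n\<close>, registers 2 and 3 are scratch space,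
  variable \<open>x\<close> lives in register \<open>4 + x\<close>, and the array cells occupy the registers from 16 on.
\<close>

definition address :: "nat \<Rightarrow> nat \<Rightarrow> nat \<Rightarrow> nat" where
  "address a i j = 16 * prod_encode (i, j) + (16 + a)"

text \<open>The array number is the residue modulo 16 and the pairing function separates the index
  pairs. The offset 16 keeps all cells above the variable registers \<open>4 + x\<close> with
  \<open>x < 12\<close>.\<close>

lemma address_inj:
  "a < 16 \<Longrightarrow> b < 16 \<Longrightarrow> address a i j = address b k l \<longleftrightarrow> a = b \<and> i = k \<and> j = l"
proof
  assume ab: "a < 16" "b < 16" and eq: "address a i j = address b k l"
  have "address a i j mod 16 = a" "address b k l mod 16 = b"
    using ab by (simp_all add: address_def)
  with eq have "a = b" by simp
  moreover from this eq have "prod_encode (i, j) = prod_encode (k, l)" by (simp add: address_def)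
  ultimately show "a = b \<and> i = k \<and> j = l" by simp
qed auto

text \<open>Leaves the address of a cell in register 3, by summing up a triangular number.\<close>

definition addr_code :: "nat \<Rightarrow> nat \<Rightarrow> nat \<Rightarrow> nat \<Rightarrow> program" where
  "addr_code l a i j =
    [Add 2 (4 + i) (4 + j), SetConst 3 0, Add 3 3 (4 + i),
     Add 3 3 2, Sub 2 2 0, JumpPos (l + 3) 2,
     Add 3 3 3, Add 3 3 3, Add 3 3 3, Add 3 3 3, SetConst 2 (int (16 + a)), Add 3 3 2]"

text \<open>A jump on register 0 is unconditional, since that register holds 1. A conditional jumps
  over the else branch, which is placed first. A loop is entered at its test, behind the increment,
  so that \<open>n = 0\<close> runs no round.\<close>

fun compile :: "nat \<Rightarrow> com \<Rightarrow> program" where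
  "compile l Skip = []"
| "compile l (Assign a i j c) = addr_code l a i j @ [SetConst 2 (int c), Store 3 2]"
| "compile l (AssignIdx a i j x) = addr_code l a i j @ [Store 3 (4 + x)]"
| "compile l (Input a i j) = addr_code l a i j @ [Read 2, Store 3 2]"
| "compile l (Output c) = [SetConst 2 c, Print 2]"
| "compile l (Seq c d) = (let C = compile l c in C @ compile (l + length C) d)"
| "compile l (IfPos a i j c d) =
    (let D = compile (l + 14) d; m = l + 15 + length D; C = compile m c in
     addr_code l a i j @ [Load 2 3, JumpPos m 2] @ D @ [JumpPos (m + length C) 0] @ C)"
| "compile l (For x c) =
    (let C = compile (l + 2) c in
     [SetConst (4 + x) 0, JumpPos (l + 3 + length C) 0] @ C @
     [Add (4 + x) (4 + x) 0, Sub 2 1 (4 + x), JumpPos (l + 2) 2])"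
| "compile l (Let x a i j c) = addr_code l a i j @ [Load (4 + x) 3] @ compile (l + 13) c"

text \<open>For indices up to \<open>n + 1\<close> the pairing function is at most
  \<open>triangle (2 * (n + 1)) + (n + 1)\<close>; multiplying by 16 and adding at most 31 gives the
  largest address.\<close>

definition value_bound :: "nat \<Rightarrow> nat" where
  "value_bound n = 32 * (n + 1) * (n + 1) + 32 * (n + 1) + 32"

text \<open>One instruction is charged for at most two integers, each of size at most
  \<open>value_bound n + 1\<close>.\<close>

definition step_bound :: "nat \<Rightarrow> nat" where
  "step_bound n = 2 * value_bound n + 2"

text \<open>Computing an address takes at most \<open>6 * n + 18\<close> instructions; the remaining
  12 cover whatever a command does besides.\<close>

definition cell_bound :: "nat \<Rightarrow> nat" where
  "cell_bound n = (6 * n + 30) * step_bound n"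

text \<open>Both branches of a conditional are charged instead of their maximum, which keeps every
  clause a polynomial expression.\<close>

fun time_bound :: "nat \<Rightarrow> com \<Rightarrow> nat" where
  "time_bound n (Seq c d) = time_bound n c + time_bound n d"
| "time_bound n (IfPos a i j c d) = cell_bound n + (time_bound n c + time_bound n d)"
| "time_bound n (For x c) = cell_bound n + n * (time_bound n c + cell_bound n)"
| "time_bound n (Let x a i j c) = cell_bound n + time_bound n c"
| "time_bound n _ = cell_bound n"

section \<open>Simulation of stores by machine configurations\<close>

text \<open>\<open>V\<close> holds the variables in scope. Scratch registers 2 and 3 are exempt from
  the size bound, as addresses live there. The bound is \<open>n + 1\<close> and not
  \<open>n\<close> because the constant 1 must fit even if \<open>n = 0\<close>.\<close>

definition represents ::
    "nat \<Rightarrow> nat set \<Rightarrow> (nat \<Rightarrow> nat) \<Rightarrow> store \<Rightarrow> config \<Rightarrow> bool" where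
  "represents n V e s \<sigma> \<longleftrightarrow>
     reg \<sigma> 0 = 1 \<and> reg \<sigma> 1 = int n \<and>
     (\<forall>x\<in>V. reg \<sigma> (4 + x) = int (e x)) \<and>
     (\<forall>a<16. \<forall>i j. reg \<sigma> (address a i j) = int (heap s a i j)) \<and>
     (\<forall>r. r \<noteq> 2 \<longrightarrow> r \<noteq> 3 \<longrightarrow> 0 \<le> reg \<sigma> r \<and> reg \<sigma> r \<le> int (n + 1)) \<and>
     inp \<sigma> = map int (hin s) \<and> (\<forall>x\<in>set (hin s). x \<le> n + 1) \<and> outp \<sigma> = hout s"

lemma triangle_mono: "m \<le> n \<Longrightarrow> triangle m \<le> triangle n"
  by (induction n) (auto simp: le_Suc_eq)

lemma triangle_double: "triangle (2 * m) = 2 * m * m + m"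
  by (induction m) auto

lemma address_le_value_bound:
  assumes "i \<le> n + 1" "j \<le> n + 1" "a < 16"
  shows "address a i j \<le> value_bound n"
proof -
  have "triangle (i + j) \<le> triangle (2 * (n + 1))"
    using assms by (intro triangle_mono) simp
  then have "triangle (i + j) \<le> 2 * (n + 1) * (n + 1) + (n + 1)"
    by (simp only: triangle_double)
  then have "address a i j \<le> 16 * (2 * (n + 1) * (n + 1) + (n + 1) + (n + 1)) + 31"
    unfolding address_def prod_encode_def using assms by simp
  then show ?thesis unfolding value_bound_def by (simp add: algebra_simps)
qed

lemma two_int_sizes_le_step_bound:
  "\<bar>x\<bar> \<le> int (value_bound n) \<Longrightarrow> \<bar>y\<bar> \<le> int (value_bound n) \<Longrightarrow>
    int_size x + int_size y \<le> step_bound n"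
  using int_size_bound[of x "value_bound n"] int_size_bound[of y "value_bound n"]
  unfolding step_bound_def by simp

lemma int_size_le_step_bound: "\<bar>x\<bar> \<le> int (value_bound n) \<Longrightarrow> int_size x \<le> step_bound n"
  using int_size_bound[of x "value_bound n"] unfolding step_bound_def by simp

text \<open>The loop adds \<open>m\<close>, \<open>m - 1\<close>, down to 1 to register 3. Its test
  comes last, so \<open>m = 0\<close> still runs one harmless round that adds 0 and leaves -1 in
  register 2; hence the unspecified \<open>z\<close> and the extra 3 in the bound.\<close>

lemma triangle_loop:
  assumes code: "code_at P l [Add 3 3 2, Sub 2 2 0, JumpPos l 2]"
    and "reg \<sigma> 0 = 1" "reg \<sigma> 2 = int m" "reg \<sigma> 3 = int q"
    and "m + q + triangle m \<le> value_bound n" "pc \<sigma> = l"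
  shows "\<exists>z. run_within P \<sigma> ((3 * m + 3) * step_bound n)
    (\<sigma>\<lparr>pc := l + 3, reg := (reg \<sigma>)(2 := z, 3 := int (q + triangle m))\<rparr>)"
  using assms(2-)
proof (induction m arbitrary: \<sigma> q rule: less_induct)
  case (less m)
  have vb: "1 \<le> value_bound n" by (simp add: value_bound_def)
  have c: "l < length P" "P ! l = Add 3 3 2" "Suc l < length P" "P ! Suc l = Sub 2 2 0"
      "Suc (Suc l) < length P" "P ! Suc (Suc l) = JumpPos l 2"
    using code by auto
  define \<tau> where "\<tau> = \<sigma>\<lparr>pc := (if m > 1 then l else l + 3),
      reg := (reg \<sigma>)(2 := int m - 1, 3 := int (q + m))\<rparr>"
  have "run_within P \<sigma> (step_bound n + (step_bound n + (step_bound n + 0))) \<tau>"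
    apply (rule run_within_step, (use less.prems c in simp; fail)+,
        (use less.prems in \<open>simp, intro two_int_sizes_le_step_bound; simp\<close>; fail))
    apply (rule run_within_step, (use less.prems c in simp; fail)+,
        (use less.prems vb in \<open>simp, intro two_int_sizes_le_step_bound; simp\<close>; fail))
    apply (rule run_within_step, (use less.prems c in simp; fail)+,
        (use less.prems vb in \<open>simp, intro int_size_le_step_bound; simp\<close>; fail))
    by (rule run_within_eq) (use less.prems in \<open>auto simp: \<tau>_def fun_upd_twist\<close>)
  then have st: "run_within P \<sigma> (3 * step_bound n) \<tau>" by (simp add: numeral_3_eq_3)
  show ?case
  proof (cases "m > 1")
    case True
    then obtain m' where m': "m = Suc m'" "m' > 0" by (cases m) auto
    have "\<exists>z. run_within P \<tau> ((3 * m' + 3) * step_bound n)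
      (\<tau>\<lparr>pc := l + 3, reg := (reg \<tau>)(2 := z, 3 := int (q + m + triangle m'))\<rparr>)"
      by (rule less.IH) (use less.prems m' in \<open>auto simp: \<tau>_def\<close>)
    then obtain z where "run_within P \<tau> ((3 * m' + 3) * step_bound n)
      (\<tau>\<lparr>pc := l + 3, reg := (reg \<tau>)(2 := z, 3 := int (q + m + triangle m'))\<rparr>)" ..
    from run_within_trans[OF st this]
    have "run_within P \<sigma> ((3 * m + 3) * step_bound n)
      (\<sigma>\<lparr>pc := l + 3, reg := (reg \<sigma>)(2 := z, 3 := int (q + triangle m))\<rparr>)"
      using m' by (simp add: \<tau>_def algebra_simps fun_upd_twist)
    then show ?thesis ..
  next
    case False
    then have "triangle m = m" by (cases m) auto
    with False have eq:
      "\<tau> = \<sigma>\<lparr>pc := l + 3, reg := (reg \<sigma>)(2 := int m - 1, 3 := int (q + triangle m))\<rparr>"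
      by (simp add: \<tau>_def)
    have "run_within P \<sigma> ((3 * m + 3) * step_bound n) \<tau>"
      by (rule run_within_mono[OF st]) simp
    then show ?thesis unfolding eq by (rule exI)
  qed
qed

text \<open>Since \<open>prod_encode (u, v)\<close> is \<open>u + triangle (u + v)\<close>, starting
  the summation at \<open>u\<close> yields the code of the pair; four doublings supply the factor
  16.\<close>

lemma addr_code_run:
  assumes code: "code_at P l (addr_code l a i j)"
    and pc: "pc \<sigma> = l" and one: "reg \<sigma> 0 = 1"
    and ri: "reg \<sigma> (4 + i) = int u" and rj: "reg \<sigma> (4 + j) = int v"
    and le: "u \<le> n + 1" "v \<le> n + 1" "a < 16"
  shows "run_within P \<sigma> ((6 * n + 18) * step_bound n)
    (\<sigma>\<lparr>pc := l + 12, reg := (reg \<sigma>)(2 := int (16 + a), 3 := int (address a u v))\<rparr>)"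
proof -
  let ?K = "step_bound n"
  have vb: "32 * (n + 1) + 32 \<le> value_bound n" by (simp add: value_bound_def)
  have ab: "address a u v \<le> value_bound n" by (rule address_le_value_bound) (use le in auto)
  define t where "t = prod_encode (u, v)"
  have t: "t = u + triangle (u + v)" by (simp add: t_def prod_encode_def)
  have t16: "16 * t + 16 + a \<le> value_bound n" using ab by (simp add: address_def t_def)
  have c: "code_at P (l + 3) [Add 3 3 2, Sub 2 2 0, JumpPos (l + 3) 2]"
    and c': "l < length P" "P ! l = Add 2 (4 + i) (4 + j)"
      "Suc l < length P" "P ! (Suc l) = SetConst 3 0"
      "Suc (Suc l) < length P" "P ! Suc (Suc l) = Add 3 3 (4 + i)"
      "6 + l < length P" "P ! (6 + l) = Add 3 3 3"
      "7 + l < length P" "P ! (7 + l) = Add 3 3 3"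
      "8 + l < length P" "P ! (8 + l) = Add 3 3 3"
      "9 + l < length P" "P ! (9 + l) = Add 3 3 3"
      "10 + l < length P" "P ! (10 + l) = SetConst 2 (int (16 + a))"
      "11 + l < length P" "P ! (11 + l) = Add 3 3 2"
    using code by (auto simp: addr_code_def eval_nat_numeral)
  define \<sigma>1 where "\<sigma>1 = \<sigma>\<lparr>pc := l + 3, reg := (reg \<sigma>)(2 := int (u + v), 3 := int u)\<rparr>"
  have r1: "run_within P \<sigma> (?K + (?K + (?K + 0))) \<sigma>1"
    apply (rule run_within_step, (use pc c' in simp; fail)+,
        (use ri rj le vb in \<open>simp, intro two_int_sizes_le_step_bound; simp\<close>; fail))
    apply (rule run_within_step, (use pc c' in simp; fail)+,
        (simp, intro int_size_le_step_bound, simp; fail))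
    apply (rule run_within_step, (use pc c' in simp; fail)+,
        (use ri rj le vb in \<open>simp, intro two_int_sizes_le_step_bound; simp\<close>; fail))
    by (rule run_within_eq) (use pc ri rj in \<open>auto simp: \<sigma>1_def fun_upd_twist\<close>)
  obtain z where r2: "run_within P \<sigma>1 ((3 * (u + v) + 3) * ?K)
      (\<sigma>1\<lparr>pc := l + 3 + 3, reg := (reg \<sigma>1)(2 := z, 3 := int (u + triangle (u + v)))\<rparr>)"
  proof -
    have "16 * triangle (u + v) + 16 * u \<le> value_bound n"
      using t t16 by simp
    moreover have "u + v \<le> 2 * (n + 1)" using le by simp
    ultimately have *: "(u + v) + u + triangle (u + v) \<le> value_bound n"
      using vb by linarith
    show thesis
      using triangle_loop[OF c, of \<sigma>1 "u + v" u n] one * that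
      by (auto simp: \<sigma>1_def)
  qed
  define \<sigma>2 where "\<sigma>2 = \<sigma>\<lparr>pc := 6 + l, reg := (reg \<sigma>)(2 := z, 3 := int t)\<rparr>"
  have "\<sigma>2 = \<sigma>1\<lparr>pc := l + 3 + 3, reg := (reg \<sigma>1)(2 := z, 3 := int (u + triangle (u + v)))\<rparr>"
    by (simp add: \<sigma>1_def \<sigma>2_def t fun_upd_twist)
  with r2 have r2: "run_within P \<sigma>1 ((3 * (u + v) + 3) * ?K) \<sigma>2" by simp
  have r3: "run_within P \<sigma>2 (?K + (?K + (?K + (?K + (?K + (?K + 0))))))
      (\<sigma>\<lparr>pc := l + 12, reg := (reg \<sigma>)(2 := int (16 + a), 3 := int (address a u v))\<rparr>)"
    unfolding \<sigma>2_def
    apply (rule run_within_step, (use c' in simp; fail)+,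
        (use t16 in \<open>simp, intro two_int_sizes_le_step_bound; simp\<close>; fail))
    apply (rule run_within_step, (use c' in simp; fail)+,
        (use t16 in \<open>simp, intro two_int_sizes_le_step_bound; simp\<close>; fail))
    apply (rule run_within_step, (use c' in simp; fail)+,
        (use t16 in \<open>simp, intro two_int_sizes_le_step_bound; simp\<close>; fail))
    apply (rule run_within_step, (use c' in simp; fail)+,
        (use t16 in \<open>simp, intro two_int_sizes_le_step_bound; simp\<close>; fail))
    apply (rule run_within_step, (use c' in simp; fail)+,
        (use t16 in \<open>simp, intro int_size_le_step_bound; simp\<close>; fail))
    apply (rule run_within_step, (use c' in simp; fail)+,
        (use t16 in \<open>simp, intro two_int_sizes_le_step_bound; simp\<close>; fail))
    by (rule run_within_eq) (auto simp: fun_upd_twist address_def t_def)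
  \<comment> \<open>Three instructions before the loop, \<open>3 * (u + v) + 3\<close> in it and six
    after it, where \<open>u + v\<close> is at most \<open>2 * n + 2\<close>.\<close>
  have "?K + (?K + (?K + 0)) + ((3 * (u + v) + 3) * ?K + (?K + (?K + (?K + (?K + (?K + (?K + 0)))))))
    = (3 * (u + v) + 12) * ?K" by (simp add: algebra_simps)
  also have "\<dots> \<le> (6 * n + 18) * ?K" using le by (intro mult_right_mono) auto
  finally show ?thesis
    by (rule run_within_mono[OF run_within_trans[OF r1 run_within_trans[OF r2 r3]]])
qed

lemma addr_code_length [simp]: "length (addr_code l a i j) = 12"
  by (simp add: addr_code_def)

lemma address_ge: "16 \<le> address a i j"
  by (simp add: address_def)

lemma represents_scratch:
  assumes "represents n V e s \<sigma>" "\<forall>r. r \<noteq> 2 \<longrightarrow> r \<noteq> 3 \<longrightarrow> reg \<sigma>' r = reg \<sigma> r"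
    "inp \<sigma>' = inp \<sigma>" "outp \<sigma>' = outp \<sigma>"
  shows "represents n V e s \<sigma>'"
proof -
  have "address a i j \<noteq> 2" "address a i j \<noteq> 3" for a i j
    using address_ge[of a i j] by auto
  then show ?thesis using assms by (auto simp: represents_def)
qed

text \<open>Injectivity of addresses protects the other cells; \<open>V \<subseteq> {..<12}\<close>
  keeps variable registers below 16, out of reach of any cell.\<close>

lemma represents_put:
  assumes r: "represents n V e s \<sigma>" and V: "V \<subseteq> {..<12}" and "a < 16" "v \<le> n + 1"
    and r': "\<forall>r. r \<noteq> 2 \<longrightarrow> r \<noteq> 3 \<longrightarrow> r \<noteq> address a i j \<longrightarrow> reg \<sigma>' r = reg \<sigma> r"
    and "reg \<sigma>' (address a i j) = int v" "inp \<sigma>' = inp \<sigma>" "outp \<sigma>' = outp \<sigma>"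
  shows "represents n V e (put a i j v s) \<sigma>'"
proof -
  have ne: "address b k l \<noteq> 2" "address b k l \<noteq> 3" "address b k l \<noteq> 0"
    "address b k l \<noteq> 1" for b k l
    using address_ge[of b k l] by auto
  have nv: "4 + x \<noteq> address b k l" if "x \<in> V" for x b k l
    using V that address_ge[of b k l] by (auto dest!: subsetD)
  have cell: "reg \<sigma>' (address b k l) = int (if b = a \<and> k = i \<and> l = j then v else heap s b k l)"
    if "b < 16" for b k l
    using assms that ne address_inj[of b a k l i j] by (auto simp: represents_def)
  have bd: "0 \<le> reg \<sigma>' r \<and> reg \<sigma>' r \<le> int (n + 1)" if "r \<noteq> 2" "r \<noteq> 3" for r
    using assms that by (cases "r = address a i j") (auto simp: represents_def)
  have var: "reg \<sigma>' (4 + x) = int (e x)" if "x \<in> V" for x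
    using assms that nv[OF that] by (auto simp: represents_def)
  have c: "reg \<sigma>' 0 = 1" "reg \<sigma>' 1 = int n"
    using r r' ne(3,4)[of a i j] by (auto simp: represents_def)
  have io: "inp \<sigma>' = map int (hin s)" "\<forall>x\<in>set (hin s). x \<le> n + 1" "outp \<sigma>' = hout s"
    using assms by (auto simp: represents_def)
  show ?thesis
    unfolding represents_def put_simps
    by (intro conjI allI ballI impI) (use c io cell var bd in auto)
qed

lemma represents_bind:
  assumes r: "represents n V e s \<sigma>" and x: "x < 12" "x \<notin> V" and "v \<le> n + 1"
    and r': "\<forall>r. r \<noteq> 2 \<longrightarrow> r \<noteq> 3 \<longrightarrow> r \<noteq> 4 + x \<longrightarrow> reg \<sigma>' r = reg \<sigma> r"
    and "reg \<sigma>' (4 + x) = int v" "inp \<sigma>' = inp \<sigma>" "outp \<sigma>' = outp \<sigma>"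
  shows "represents n (insert x V) (e(x := v)) s \<sigma>'"
proof -
  have ne: "address b k l \<noteq> 2" "address b k l \<noteq> 3" "address b k l \<noteq> 4 + x" for b k l
    using address_ge[of b k l] x by auto
  have bd: "0 \<le> reg \<sigma>' r \<and> reg \<sigma>' r \<le> int (n + 1)" if "r \<noteq> 2" "r \<noteq> 3" for r
    using assms that by (cases "r = 4 + x") (auto simp: represents_def)
  have var: "reg \<sigma>' (4 + y) = int ((e(x := v)) y)" if "y \<in> insert x V" for y
    using assms that by (auto simp: represents_def)
  have "reg \<sigma>' 0 = 1" "reg \<sigma>' 1 = int n"
    "\<forall>a<16. \<forall>i j. reg \<sigma>' (address a i j) = int (heap s a i j)"
    using r r' ne by (auto simp: represents_def)
  then show ?thesis
    using bd var assms unfolding represents_def by (simp del: fun_upd_apply)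
qed

text \<open>Leaving a scope costs no instruction: the register keeps its value, and freshness of
  \<open>x\<close> means that nothing is claimed about it any more.\<close>

lemma represents_unbind:
  "represents n (insert x V) (e(x := v)) s \<sigma> \<Longrightarrow> x \<notin> V \<Longrightarrow> represents n V e s \<sigma>"
  by (auto simp: represents_def)

lemma represents_env_le: "represents n V e s \<sigma> \<Longrightarrow> x \<in> V \<Longrightarrow> e x \<le> n + 1"
proof -
  assume r: "represents n V e s \<sigma>" and x: "x \<in> V"
  have "4 + x \<noteq> 2" "4 + x \<noteq> 3" by simp_all
  then have "reg \<sigma> (4 + x) \<le> int (n + 1)" "reg \<sigma> (4 + x) = int (e x)"
    using r x unfolding represents_def by blast+
  then show ?thesis by simp
qed

lemma represents_heap_le: "represents n V e s \<sigma> \<Longrightarrow> a < 16 \<Longrightarrow> heap s a i j \<le> n + 1"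
proof -
  assume r: "represents n V e s \<sigma>" and a: "a < 16"
  have "address a i j \<noteq> 2" "address a i j \<noteq> 3" using address_ge[of a i j] by auto
  then have "reg \<sigma> (address a i j) \<le> int (n + 1)" "reg \<sigma> (address a i j) = int (heap s a i j)"
    using r a unfolding represents_def by blast+
  then show ?thesis by simp
qed

lemma value_bound_ge: "n + 33 \<le> value_bound n"
  by (simp add: value_bound_def)

lemma locate_cell:
  assumes "code_at P l (addr_code l a i j)" "represents n V e s \<sigma>" "pc \<sigma> = l"
    and "i \<in> V" "j \<in> V" "a < 16"
  obtains \<sigma>' where "run_within P \<sigma> ((6 * n + 18) * step_bound n) \<sigma>'" "pc \<sigma>' = l + 12"
    "represents n V e s \<sigma>'" "reg \<sigma>' 3 = int (address a (e i) (e j))"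
    "address a (e i) (e j) \<le> value_bound n"
proof
  let ?\<sigma> = "\<sigma>\<lparr>pc := l + 12, reg := (reg \<sigma>)(2 := int (16 + a), 3 := int (address a (e i) (e j)))\<rparr>"
  show "run_within P \<sigma> ((6 * n + 18) * step_bound n) ?\<sigma>"
    using assms represents_env_le[OF assms(2)]
    by (intro addr_code_run) (auto simp: represents_def)
  show "represents n V e s ?\<sigma>" by (rule represents_scratch[OF assms(2)]) auto
  show "address a (e i) (e j) \<le> value_bound n"
    using assms represents_env_le[OF assms(2)] by (intro address_le_value_bound) auto
qed auto

lemma run_one:
  assumes "pc \<sigma> < length P" "P ! pc \<sigma> = ins" "exec_instr ins \<sigma> = Some \<sigma>'" "instr_cost ins \<sigma> \<le> k"
  shows "run_within P \<sigma> k \<sigma>'"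
  using run_within_step[OF assms run_within_refl[of P \<sigma>' 0]] by simp

lemma cell_bound_eq: "cell_bound n = (6 * n + 18) * step_bound n + 12 * step_bound n"
  by (simp add: cell_bound_def algebra_simps)

lemma run_two:
  assumes "pc \<sigma> < length P" "P ! pc \<sigma> = ins" "exec_instr ins \<sigma> = Some \<sigma>1" "instr_cost ins \<sigma> \<le> k"
    and "pc \<sigma>1 < length P" "P ! pc \<sigma>1 = ins'" "exec_instr ins' \<sigma>1 = Some \<sigma>2" "instr_cost ins' \<sigma>1 \<le> k"
  shows "run_within P \<sigma> (2 * k) \<sigma>2"
  using run_within_trans[OF run_one[OF assms(1-4)] run_one[OF assms(5-8)]] by (simp add: mult_2)

text \<open>A forward simulation by induction on the command, carrying result and time together. The
  position, scope and environment vary because loop bodies and branches are compiled elsewhere and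
  run with more variables bound.\<close>

lemma compile_correct:
  assumes "code_at P l (compile l c)" "wf_com V c" "V \<subseteq> {..<12}"
    and "represents n V e s \<sigma>" "pc \<sigma> = l"
  shows "\<exists>\<sigma>'. run_within P \<sigma> (time_bound n c) \<sigma>' \<and> pc \<sigma>' = l + length (compile l c) \<and>
    represents n V e (sem n c e s) \<sigma>'"
  using assms
proof (induction c arbitrary: l V e s \<sigma>)
  case Skip
  then show ?case by (intro exI[of _ \<sigma>]) (auto simp: run_within_refl)
next
  case (Assign a i j c)
  have code: "code_at P l (addr_code l a i j)" "code_at P (l + 12) [SetConst 2 (int c), Store 3 2]"
    using Assign.prems by (auto simp: code_at_append)
  obtain \<sigma>1 where \<sigma>1: "run_within P \<sigma> ((6 * n + 18) * step_bound n) \<sigma>1" "pc \<sigma>1 = l + 12"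
    "represents n V e s \<sigma>1" "reg \<sigma>1 3 = int (address a (e i) (e j))"
    "address a (e i) (e j) \<le> value_bound n"
    using locate_cell[OF code(1)] Assign.prems by (metis wf_com.simps(2))
  let ?\<sigma> = "\<sigma>1\<lparr>pc := 14 + l, reg := (reg \<sigma>1)(2 := int c, address a (e i) (e j) := int c)\<rparr>"
  let ?\<tau> = "\<sigma>1\<lparr>pc := 13 + l, reg := (reg \<sigma>1)(2 := int c)\<rparr>"
  have c: "c \<le> 1" "a < 16" using Assign.prems by auto
  have "run_within P \<sigma>1 (2 * step_bound n) ?\<sigma>"
  proof (rule run_two)
    show "instr_cost (SetConst 2 (int c)) \<sigma>1 \<le> step_bound n"
      using c value_bound_ge[of n] by (simp, intro int_size_le_step_bound) auto
    show "instr_cost (Store 3 2) ?\<tau> \<le> step_bound n"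
      using c value_bound_ge[of n] \<sigma>1 by (simp, intro two_int_sizes_le_step_bound) auto
  qed (use code \<sigma>1 in auto)
  with \<sigma>1(1) have "run_within P \<sigma> ((6 * n + 18) * step_bound n + 2 * step_bound n) ?\<sigma>"
    by (rule run_within_trans)
  then have "run_within P \<sigma> (cell_bound n) ?\<sigma>"
    by (rule run_within_mono) (simp add: cell_bound_eq)
  moreover have "represents n V e (put a (e i) (e j) c s) ?\<sigma>"
    by (rule represents_put[OF \<sigma>1(3) Assign.prems(3) c(2)]) (use c in auto)
  ultimately show ?case by (intro exI[of _ ?\<sigma>]) auto
next
  case (AssignIdx a i j x)
  have code: "code_at P l (addr_code l a i j)" "code_at P (l + 12) [Store 3 (4 + x)]"
    using AssignIdx.prems by (auto simp: code_at_append)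
  obtain \<sigma>1 where \<sigma>1: "run_within P \<sigma> ((6 * n + 18) * step_bound n) \<sigma>1" "pc \<sigma>1 = l + 12"
    "represents n V e s \<sigma>1" "reg \<sigma>1 3 = int (address a (e i) (e j))"
    "address a (e i) (e j) \<le> value_bound n"
    using locate_cell[OF code(1)] AssignIdx.prems by (metis wf_com.simps(3))
  let ?\<sigma> = "\<sigma>1\<lparr>pc := 13 + l, reg := (reg \<sigma>1)(address a (e i) (e j) := int (e x))\<rparr>"
  have a: "a < 16" and ex: "reg \<sigma>1 (4 + x) = int (e x)" "e x \<le> n + 1"
    using \<sigma>1(3) represents_env_le[OF \<sigma>1(3)] AssignIdx.prems by (auto simp: represents_def)
  have "run_within P \<sigma>1 (step_bound n) ?\<sigma>"
  proof (rule run_one)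
    show "instr_cost (Store 3 (4 + x)) \<sigma>1 \<le> step_bound n"
      using ex value_bound_ge[of n] \<sigma>1 by (simp, intro two_int_sizes_le_step_bound) auto
  qed (use code \<sigma>1 ex in auto)
  with \<sigma>1(1) have "run_within P \<sigma> ((6 * n + 18) * step_bound n + step_bound n) ?\<sigma>"
    by (rule run_within_trans)
  then have "run_within P \<sigma> (cell_bound n) ?\<sigma>"
    by (rule run_within_mono) (simp add: cell_bound_eq)
  moreover have "represents n V e (put a (e i) (e j) (e x) s) ?\<sigma>"
    by (rule represents_put[OF \<sigma>1(3) AssignIdx.prems(3) a ex(2)]) auto
  ultimately show ?case by (intro exI[of _ ?\<sigma>]) auto
next
  case (Input a i j)
  have code: "code_at P l (addr_code l a i j)" "code_at P (l + 12) [Read 2, Store 3 2]"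
    using Input.prems by (auto simp: code_at_append)
  obtain \<sigma>1 where \<sigma>1: "run_within P \<sigma> ((6 * n + 18) * step_bound n) \<sigma>1" "pc \<sigma>1 = l + 12"
    "represents n V e s \<sigma>1" "reg \<sigma>1 3 = int (address a (e i) (e j))"
    "address a (e i) (e j) \<le> value_bound n"
    using locate_cell[OF code(1)] Input.prems by (metis wf_com.simps(4))
  define c where "c = (case hin s of [] \<Rightarrow> 0 | x # _ \<Rightarrow> x)"
  have ic: "(case inp \<sigma>1 of [] \<Rightarrow> 0 | x # _ \<Rightarrow> x) = int c"
    using \<sigma>1(3) by (auto simp: represents_def c_def split: list.splits)
  have "\<forall>x\<in>set (hin s). x \<le> n + 1" using \<sigma>1(3) by (simp add: represents_def)
  then have c: "c \<le> n + 1" "a < 16" using Input.prems by (auto simp: c_def split: list.splits)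
  let ?\<sigma> = "\<sigma>1\<lparr>pc := 14 + l, reg := (reg \<sigma>1)(2 := int c, address a (e i) (e j) := int c),
    inp := tl (inp \<sigma>1)\<rparr>"
  let ?\<tau> = "\<sigma>1\<lparr>pc := 13 + l, reg := (reg \<sigma>1)(2 := int c), inp := tl (inp \<sigma>1)\<rparr>"
  have "run_within P \<sigma>1 (2 * step_bound n) ?\<sigma>"
  proof (rule run_two)
    show "instr_cost (Read 2) \<sigma>1 \<le> step_bound n"
      using c value_bound_ge[of n] ic by (simp, intro int_size_le_step_bound) auto
    show "instr_cost (Store 3 2) ?\<tau> \<le> step_bound n"
      using c value_bound_ge[of n] \<sigma>1 by (simp, intro two_int_sizes_le_step_bound) auto
  qed (use code \<sigma>1 ic in auto)
  with \<sigma>1(1) have "run_within P \<sigma> ((6 * n + 18) * step_bound n + 2 * step_bound n) ?\<sigma>"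
    by (rule run_within_trans)
  then have run: "run_within P \<sigma> (cell_bound n) ?\<sigma>"
    by (rule run_within_mono) (simp add: cell_bound_eq)
  \<comment> \<open>The write is justified first with the input tape left as it was; then both tapes
    are advanced together.\<close>
  have "represents n V e (put a (e i) (e j) c s)
      (\<sigma>1\<lparr>pc := 14 + l, reg := (reg \<sigma>1)(2 := int c, address a (e i) (e j) := int c)\<rparr>)"
    by (rule represents_put[OF \<sigma>1(3) Input.prems(3) c(2) c(1)]) auto
  moreover have "set (tl (hin s)) \<subseteq> set (hin s)" by (cases "hin s") auto
  ultimately have "represents n V e ((put a (e i) (e j) c s)\<lparr>hin := tl (hin s)\<rparr>) ?\<sigma>"
    by (auto simp: represents_def map_tl)
  with run show ?case by (intro exI[of _ ?\<sigma>]) (auto simp: c_def)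
next
  case (Output c)
  let ?\<sigma> = "\<sigma>\<lparr>pc := l + 2, reg := (reg \<sigma>)(2 := c), outp := outp \<sigma> @ [c]\<rparr>"
  have c: "\<bar>c\<bar> \<le> int (value_bound n)" using Output.prems value_bound_ge[of n] by simp
  have "run_within P \<sigma> (2 * step_bound n) ?\<sigma>"
    by (rule run_two[where ins = "SetConst 2 c" and ins' = "Print 2"])
      (use Output.prems int_size_le_step_bound[OF c] in auto)
  then have "run_within P \<sigma> (cell_bound n) ?\<sigma>"
    by (rule run_within_mono) (simp add: cell_bound_eq)
  moreover have "represents n V e s (\<sigma>\<lparr>pc := l + 2, reg := (reg \<sigma>)(2 := c)\<rparr>)"
    by (rule represents_scratch[OF Output.prems(4)]) auto
  then have "represents n V e (s\<lparr>hout := hout s @ [c]\<rparr>) ?\<sigma>"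
    by (auto simp: represents_def)
  ultimately show ?case by (intro exI[of _ ?\<sigma>]) auto
next
  case (Seq c d)
  obtain \<sigma>1 where \<sigma>1: "run_within P \<sigma> (time_bound n c) \<sigma>1" "pc \<sigma>1 = l + length (compile l c)"
    "represents n V e (sem n c e s) \<sigma>1"
    using Seq.IH(1)[of l V e s \<sigma>] Seq.prems by (auto simp: Let_def code_at_append)
  obtain \<sigma>2 where \<sigma>2: "run_within P \<sigma>1 (time_bound n d) \<sigma>2"
    "pc \<sigma>2 = l + length (compile l c) + length (compile (l + length (compile l c)) d)"
    "represents n V e (sem n d e (sem n c e s)) \<sigma>2"
    using Seq.IH(2)[of "l + length (compile l c)" V e "sem n c e s" \<sigma>1] Seq.prems \<sigma>1
    by (auto simp: Let_def code_at_append)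
  then show ?case
    using run_within_trans[OF \<sigma>1(1) \<sigma>2(1)] by (intro exI[of _ \<sigma>2]) (auto simp: Let_def)
next
  case (IfPos a i j c d)
  define D where "D = compile (l + 14) d"
  define m where "m = l + 15 + length D"
  define C where "C = compile m c"
  have len: "length (compile l (IfPos a i j c d)) = 15 + length D + length C"
    by (simp add: D_def[symmetric] m_def[symmetric] C_def[symmetric] Let_def)
  have code: "code_at P l (addr_code l a i j)" "code_at P (l + 12) [Load 2 3, JumpPos m 2]"
    "code_at P (l + 14) D" "code_at P (l + 14 + length D) [JumpPos (m + length C) 0]"
    "code_at P m C"
    using IfPos.prems(1)
    by (auto simp: code_at_append Let_def D_def[symmetric] m_def[symmetric] C_def[symmetric])
      (auto simp: m_def algebra_simps)
  have one: "int_size 1 \<le> step_bound n"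
    using value_bound_ge[of n] by (intro int_size_le_step_bound) auto
  obtain \<sigma>1 where \<sigma>1: "run_within P \<sigma> ((6 * n + 18) * step_bound n) \<sigma>1" "pc \<sigma>1 = l + 12"
    "represents n V e s \<sigma>1" "reg \<sigma>1 3 = int (address a (e i) (e j))"
    "address a (e i) (e j) \<le> value_bound n"
    using locate_cell[OF code(1)] IfPos.prems by (metis wf_com.simps(7))
  define v where "v = heap s a (e i) (e j)"
  have a: "a < 16" using IfPos.prems by simp
  have v: "v \<le> n + 1" "reg \<sigma>1 (address a (e i) (e j)) = int v"
    using represents_heap_le[OF \<sigma>1(3) a] \<sigma>1(3) a by (auto simp: v_def represents_def)
  define \<sigma>2 where "\<sigma>2 = \<sigma>1\<lparr>pc := (if v > 0 then m else 14 + l), reg := (reg \<sigma>1)(2 := int v)\<rparr>"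
  have "run_within P \<sigma>1 (2 * step_bound n) \<sigma>2"
  proof (rule run_two)
    show "instr_cost (Load 2 3) \<sigma>1 \<le> step_bound n"
      using v value_bound_ge[of n] \<sigma>1 by (simp, intro two_int_sizes_le_step_bound) auto
    show "instr_cost (JumpPos m 2) (\<sigma>1\<lparr>pc := 13 + l, reg := (reg \<sigma>1)(2 := int v)\<rparr>) \<le> step_bound n"
      using v value_bound_ge[of n] by (simp, intro int_size_le_step_bound) auto
  qed (use code \<sigma>1 v in \<open>auto simp: \<sigma>2_def\<close>)
  with \<sigma>1(1) have r2: "run_within P \<sigma> ((6 * n + 18) * step_bound n + 2 * step_bound n) \<sigma>2"
    by (rule run_within_trans)
  have rep2: "represents n V e s \<sigma>2"
    by (rule represents_scratch[OF \<sigma>1(3)]) (auto simp: \<sigma>2_def)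
  show ?case
  proof (cases "v > 0")
    case True
    obtain \<sigma>3 where \<sigma>3: "run_within P \<sigma>2 (time_bound n c) \<sigma>3" "pc \<sigma>3 = m + length C"
      "represents n V e (sem n c e s) \<sigma>3"
      using IfPos.IH(1)[of m V e s \<sigma>2] IfPos.prems code rep2 True
      by (auto simp: \<sigma>2_def C_def)
    have "run_within P \<sigma> (time_bound n (IfPos a i j c d)) \<sigma>3"
      by (rule run_within_mono[OF run_within_trans[OF r2 \<sigma>3(1)]]) (simp add: cell_bound_eq)
    then show ?thesis using \<sigma>3 True len m_def v_def by (intro exI[of _ \<sigma>3]) auto
  next
    case False
    obtain \<sigma>3 where \<sigma>3: "run_within P \<sigma>2 (time_bound n d) \<sigma>3" "pc \<sigma>3 = l + 14 + length D"
      "represents n V e (sem n d e s) \<sigma>3"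
      using IfPos.IH(2)[of "l + 14" V e s \<sigma>2] IfPos.prems code rep2 False
      by (auto simp: \<sigma>2_def D_def)
    let ?\<sigma> = "\<sigma>3\<lparr>pc := m + length C\<rparr>"
    have "run_within P \<sigma>3 (step_bound n) ?\<sigma>"
      by (rule run_one) (use code \<sigma>3 one in \<open>auto simp: represents_def\<close>)
    then have "run_within P \<sigma> (time_bound n (IfPos a i j c d)) ?\<sigma>"
      by (intro run_within_mono[OF run_within_trans[OF r2 run_within_trans[OF \<sigma>3(1)]]])
        (auto simp: cell_bound_eq)
    moreover have "represents n V e (sem n d e s) ?\<sigma>"
      by (rule represents_scratch[OF \<sigma>3(3)]) auto
    ultimately show ?thesis using False len m_def v_def by (intro exI[of _ ?\<sigma>]) auto
  qed
next
  case (For x c)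
  define C where "C = compile (Suc (Suc l)) c"
  define t where "t = Suc (Suc (Suc (l + length C)))"
  let ?V = "insert x V"
  let ?f = "\<lambda>k. sem n c (e(x := k))"
  have len: "l + length (compile l (For x c)) = t + 2"
    by (simp add: t_def C_def[symmetric] Let_def)
  have code: "code_at P l [SetConst (4 + x) 0, JumpPos t 0]" "code_at P (l + 2) C"
    "code_at P (l + 2 + length C) [Add (4 + x) (4 + x) 0]"
    "code_at P t [Sub 2 1 (4 + x), JumpPos (l + 2) 2]"
    using For.prems(1) by (auto simp: code_at_append Let_def C_def[symmetric] t_def)
  have x: "x < 12" "x \<notin> V" and wf: "wf_com ?V c" and V': "?V \<subseteq> {..<12}"
    using For.prems by auto
  \<comment> \<open>The machine stands at the test with \<open>x\<close> equal to \<open>k\<close>.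
    A round costs two instructions for the test and one for the increment besides the body; the
    failing test costs two more.\<close>
  have loop: "\<exists>\<sigma>'. run_within P \<sigma> ((n - k) * (time_bound n c + 3 * step_bound n) + 2 * step_bound n) \<sigma>' \<and>
      pc \<sigma>' = t + 2 \<and> represents n V e (fold ?f [k..<n] s) \<sigma>'"
    if "k \<le> n" "represents n ?V (e(x := k)) s \<sigma>" "pc \<sigma> = t" for k s \<sigma>
    using that
  proof (induction "n - k" arbitrary: k s \<sigma>)
    have test: "run_within P \<sigma> (2 * step_bound n)
      (\<sigma>\<lparr>pc := (if k < n then l + 2 else t + 2), reg := (reg \<sigma>)(2 := int n - int k)\<rparr>)"
      if "k \<le> n" "represents n ?V (e(x := k)) s \<sigma>" "pc \<sigma> = t" for k s \<sigma>
    proof (rule run_two)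
      have r: "reg \<sigma> 1 = int n" "reg \<sigma> (4 + x) = int k"
        using that by (auto simp: represents_def)
      let ?\<tau> = "\<sigma>\<lparr>pc := Suc t, reg := (reg \<sigma>)(2 := int n - int k)\<rparr>"
      show "instr_cost (Sub 2 1 (4 + x)) \<sigma> \<le> step_bound n"
        using r that value_bound_ge[of n] by (simp, intro two_int_sizes_le_step_bound) auto
      show "instr_cost (JumpPos (l + 2) 2) ?\<tau> \<le> step_bound n"
        using that value_bound_ge[of n] by (simp, intro int_size_le_step_bound) auto
    qed (use code that in \<open>auto simp: represents_def\<close>)
    {
      case 0
      let ?\<sigma> = "\<sigma>\<lparr>pc := t + 2, reg := (reg \<sigma>)(2 := int n - int k)\<rparr>"
      have "represents n ?V (e(x := k)) s ?\<sigma>"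
        by (rule represents_scratch[OF 0(3)]) auto
      with x(2) have "represents n V e s ?\<sigma>" by (blast intro: represents_unbind)
      then show ?case using test[OF 0(2-4)] 0 by (intro exI[of _ ?\<sigma>]) auto
    next
      case (Suc d)
      then have k: "k < n" and d: "d = n - Suc k" by simp_all
      let ?\<tau> = "\<sigma>\<lparr>pc := l + 2, reg := (reg \<sigma>)(2 := int n - int k)\<rparr>"
      have "represents n ?V (e(x := k)) s ?\<tau>"
        by (rule represents_scratch[OF Suc(4)]) auto
      then obtain \<sigma>1 where \<sigma>1: "run_within P ?\<tau> (time_bound n c) \<sigma>1" "pc \<sigma>1 = l + 2 + length C"
        "represents n ?V (e(x := k)) (?f k s) \<sigma>1"
        using For.IH[of "Suc (Suc l)" ?V "e(x := k)" s ?\<tau>] code wf V'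
        by (auto simp: C_def simp del: fun_upd_apply)
      let ?\<sigma>2 = "\<sigma>1\<lparr>pc := t, reg := (reg \<sigma>1)(4 + x := int k + 1)\<rparr>"
      have r: "reg \<sigma>1 0 = 1" "reg \<sigma>1 (4 + x) = int k"
        using \<sigma>1 by (auto simp: represents_def)
      have add: "run_within P \<sigma>1 (step_bound n) ?\<sigma>2"
      proof (rule run_one)
        show "instr_cost (Add (4 + x) (4 + x) 0) \<sigma>1 \<le> step_bound n"
          using r k value_bound_ge[of n] by (simp, intro two_int_sizes_le_step_bound) auto
      qed (use code \<sigma>1 r in \<open>auto simp: t_def\<close>)
      \<comment> \<open>The loop variable is taken out of scope and bound afresh to
        \<open>Suc k\<close>, since binding requires a fresh variable.\<close>
      have "represents n V e (?f k s) \<sigma>1" using represents_unbind[OF \<sigma>1(3) x(2)] .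
      then have "represents n ?V (e(x := Suc k)) (?f k s) ?\<sigma>2"
        by (rule represents_bind) (use x k in auto)
      then obtain \<sigma>3 where \<sigma>3:
        "run_within P ?\<sigma>2 ((n - Suc k) * (time_bound n c + 3 * step_bound n) + 2 * step_bound n) \<sigma>3"
        "pc \<sigma>3 = t + 2" "represents n V e (fold ?f [Suc k..<n] (?f k s)) \<sigma>3"
        using Suc(1)[of "Suc k" "?f k s" ?\<sigma>2] d k
        by (auto simp del: fun_upd_apply)
      have "run_within P \<sigma> (2 * step_bound n) ?\<tau>" using test[OF Suc(3-5)] k by simp
      from run_within_trans[OF this run_within_trans[OF \<sigma>1(1) run_within_trans[OF add \<sigma>3(1)]]]
      have "run_within P \<sigma> ((n - k) * (time_bound n c + 3 * step_bound n) + 2 * step_bound n) \<sigma>3"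
      proof (rule run_within_mono)
        have "n - k = Suc (n - Suc k)" using k by simp
        then show "2 * step_bound n + (time_bound n c + (step_bound n +
            ((n - Suc k) * (time_bound n c + 3 * step_bound n) + 2 * step_bound n)))
          \<le> (n - k) * (time_bound n c + 3 * step_bound n) + 2 * step_bound n"
          by simp
      qed
      then show ?case using \<sigma>3 k by (auto simp: upt_conv_Cons simp del: fun_upd_apply)
    }
  qed
  let ?\<tau> = "\<sigma>\<lparr>pc := t, reg := (reg \<sigma>)(4 + x := 0)\<rparr>"
  have one: "int_size 1 \<le> step_bound n" "int_size 0 \<le> step_bound n"
    using value_bound_ge[of n] by (intro int_size_le_step_bound; simp)+
  have start: "run_within P \<sigma> (2 * step_bound n) ?\<tau>"
    by (rule run_two[where ins = "SetConst (4 + x) 0" and ins' = "JumpPos t 0"])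
      (use code For.prems(4,5) one in \<open>auto simp: represents_def\<close>)
  have "represents n ?V (e(x := 0)) s ?\<tau>"
    by (rule represents_bind[OF For.prems(4) x]) auto
  with loop[of 0 s ?\<tau>] obtain \<sigma>' where \<sigma>':
    "run_within P ?\<tau> (n * (time_bound n c + 3 * step_bound n) + 2 * step_bound n) \<sigma>'"
    "pc \<sigma>' = t + 2" "represents n V e (fold ?f [0..<n] s) \<sigma>'"
    by (auto simp del: fun_upd_apply)
  have "run_within P \<sigma> (time_bound n (For x c)) \<sigma>'"
  proof (rule run_within_mono[OF run_within_trans[OF start \<sigma>'(1)]])
    have "n * (time_bound n c + 3 * step_bound n) \<le> n * (time_bound n c + cell_bound n)"
      by (intro mult_left_mono) (auto simp: cell_bound_eq)
    moreover have "4 * step_bound n \<le> cell_bound n" by (simp add: cell_bound_eq)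
    ultimately show "2 * step_bound n +
      (n * (time_bound n c + 3 * step_bound n) + 2 * step_bound n) \<le> time_bound n (For x c)"
      unfolding time_bound.simps by linarith
  qed
  then show ?case using \<sigma>' len by auto
next
  case (Let x a i j c)
  have code: "code_at P l (addr_code l a i j)" "code_at P (l + 12) [Load (4 + x) 3]"
    "code_at P (l + 13) (compile (l + 13) c)"
    using Let.prems by (auto simp: code_at_append add.commute[of l 13])
  obtain \<sigma>1 where \<sigma>1: "run_within P \<sigma> ((6 * n + 18) * step_bound n) \<sigma>1" "pc \<sigma>1 = l + 12"
    "represents n V e s \<sigma>1" "reg \<sigma>1 3 = int (address a (e i) (e j))"
    "address a (e i) (e j) \<le> value_bound n"
    using locate_cell[OF code(1)] Let.prems by (metis wf_com.simps(9))
  have a: "a < 16" and x: "x < 12" "x \<notin> V" and wf: "wf_com (insert x V) c"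
    using Let.prems by auto
  define v where "v = heap s a (e i) (e j)"
  have v: "v \<le> n + 1" "reg \<sigma>1 (address a (e i) (e j)) = int v"
    using represents_heap_le[OF \<sigma>1(3) a] \<sigma>1(3) a by (auto simp: v_def represents_def)
  define \<sigma>2 where "\<sigma>2 = \<sigma>1\<lparr>pc := 13 + l, reg := (reg \<sigma>1)(4 + x := int v)\<rparr>"
  have "run_within P \<sigma>1 (step_bound n) \<sigma>2"
  proof (rule run_one)
    show "instr_cost (Load (4 + x) 3) \<sigma>1 \<le> step_bound n"
      using v value_bound_ge[of n] \<sigma>1 by (simp, intro two_int_sizes_le_step_bound) auto
  qed (use code \<sigma>1 v in \<open>auto simp: \<sigma>2_def\<close>)
  with \<sigma>1(1) have r2: "run_within P \<sigma> ((6 * n + 18) * step_bound n + step_bound n) \<sigma>2"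
    by (rule run_within_trans)
  have "represents n (insert x V) (e(x := v)) s \<sigma>2"
    by (rule represents_bind[OF \<sigma>1(3) x v(1)]) (auto simp: \<sigma>2_def)
  then obtain \<sigma>3 where \<sigma>3: "run_within P \<sigma>2 (time_bound n c) \<sigma>3"
    "pc \<sigma>3 = l + 13 + length (compile (l + 13) c)"
    "represents n (insert x V) (e(x := v)) (sem n c (e(x := v)) s) \<sigma>3"
    using Let.IH[of "l + 13" "insert x V" "e(x := v)" s \<sigma>2] code wf x Let.prems(3)
    by (auto simp: \<sigma>2_def simp del: fun_upd_apply)
  have "run_within P \<sigma> (time_bound n (Let x a i j c)) \<sigma>3"
    by (rule run_within_mono[OF run_within_trans[OF r2 \<sigma>3(1)]]) (simp add: cell_bound_eq)
  then show ?case
    using \<sigma>3 represents_unbind[OF \<sigma>3(3) x(2)] v_def by (intro exI[of _ \<sigma>3]) auto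
qed

subsection \<open>The elimination program\<close>

lemma fold_upt_induct:
  assumes "I 0 s" "\<And>k s. k < n \<Longrightarrow> I k s \<Longrightarrow> I (Suc k) (f k s)"
  shows "I n (fold f [0..<n] s)"
  using assms by (induction n arbitrary: s) auto

text \<open>
  Array 0 holds the adjacency matrix, arrays 9 and 2 the reduced rows and the sets of original rows
  they are sums of, row 0 of arrays 3 and 4 the row in progress and its set, row 0 of array 5 the
  pivots, array 6 the prefix parities; cells \<open>(0, 0)\<close> of arrays 7 and 8 are flags. Variable 0 is
  never bound and keeps the value 0.
\<close>

definition toggle :: "nat \<Rightarrow> nat \<Rightarrow> nat \<Rightarrow> com" where
  "toggle a i j = IfPos a i j (Assign a i j 0) (Assign a i j 1)"

definition copy :: "nat \<Rightarrow> nat \<Rightarrow> nat \<Rightarrow> nat \<Rightarrow> nat \<Rightarrow> nat \<Rightarrow> com" where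
  "copy a i j b k l = IfPos b k l (Assign a i j 1) (Assign a i j 0)"

definition read_matrix :: com where
  "read_matrix = For 5 (For 2 (Input 0 5 2))"

definition start_row :: com where
  "start_row = Seq (For 2 (Seq (copy 3 0 2 0 5 2) (Assign 4 0 2 0))) (Assign 4 0 5 1)"

definition add_row :: com where
  "add_row = For 2 (Seq (IfPos 9 3 2 (toggle 3 0 2) Skip) (IfPos 2 3 2 (toggle 4 0 2) Skip))"

text \<open>The loop visits all \<open>n\<close> row slots, because loops have no other range; slots
  not yet filled hold zero rows, and adding those changes nothing.\<close>

definition reduce_row :: com where
  "reduce_row = For 3 (Let 4 5 0 3 (IfPos 3 0 4 add_row Skip))"

text \<open>Each nonzero column overwrites the candidate, so the last one becomes the pivot.\<close>

definition find_pivot :: com where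
  "find_pivot = Seq (Assign 8 0 0 0)
     (For 2 (IfPos 3 0 2 (Seq (Assign 8 0 0 1) (AssignIdx 5 0 5 2)) Skip))"

definition save_row :: com where
  "save_row = For 2 (Seq (copy 9 5 2 3 0 2) (copy 2 5 2 4 0 2))"

text \<open>The flag in array 7 replaces an early exit: once a row has vanished, the remaining
  rounds do nothing, and array 4 keeps the dependent set.\<close>

definition eliminate :: com where
  "eliminate = For 5 (IfPos 7 0 0 Skip (Seq start_row (Seq reduce_row
     (Seq find_pivot (IfPos 8 0 0 save_row (Assign 7 0 0 1))))))"

text \<open>The running parity is copied before it is toggled, so that a cell counts only the
  columns before its own.\<close>

definition compute_parities :: com where
  "compute_parities = For 5 (Seq (Assign 8 0 0 0) (For 2 (Seq (copy 6 5 2 8 0 0)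
     (IfPos 4 0 2 (IfPos 0 5 2 (toggle 8 0 0) Skip) Skip))))"

text \<open>The entry at \<open>(i, j)\<close> may need the parity at \<open>(j, i)\<close>,
  possibly from a later row; therefore all parities are tabulated before printing.\<close>

definition print_signing :: com where
  "print_signing = For 5 (For 2
     (IfPos 4 0 2 (IfPos 6 5 2 (Output (-1)) (Output 1))
       (IfPos 4 0 5 (IfPos 6 2 5 (Output (-1)) (Output 1)) (Output 1))))"

definition signing_program :: com where
  "signing_program = Seq read_matrix (Seq eliminate
     (IfPos 7 0 0 (Seq compute_parities (Seq (Output 1) print_signing)) (Output 0)))"

section \<open>Effect of the program fragments\<close>

definition same_except :: "nat set \<Rightarrow> store \<Rightarrow> store \<Rightarrow> bool" where
  "same_except B s s' \<longleftrightarrow>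
     (\<forall>b. b \<notin> B \<longrightarrow> heap s' b = heap s b) \<and> hin s' = hin s \<and> hout s' = hout s"

lemma heap_put_other [simp]: "b \<noteq> a \<Longrightarrow> heap (put a i j v s) b = heap s b"
  by (intro ext) simp

abbreviation pos :: "store \<Rightarrow> nat \<Rightarrow> nat \<Rightarrow> nat \<Rightarrow> bool" where
  "pos s a i j \<equiv> 0 < heap s a i j"

lemma sem_toggle:
  "sem n (toggle a i j) e s = put a (e i) (e j) (if pos s a (e i) (e j) then 0 else 1) s"
  by (simp add: toggle_def)

lemma sem_copy:
  "sem n (copy a i j b k l) e s = put a (e i) (e j) (of_bool (pos s b (e k) (e l))) s"
  by (simp add: copy_def)

lemma read_matrix_correct:
  fixes n :: nat and e :: "nat \<Rightarrow> nat" and s :: store and a :: "nat \<Rightarrow> nat \<Rightarrow> nat"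
  assumes "hin s = concat (map (\<lambda>i. map (a i) [0..<n]) [0..<n])"
  defines "s' \<equiv> sem n read_matrix e s"
  shows "\<forall>i<n. \<forall>j<n. heap s' 0 i j = a i j" "\<forall>b. b \<noteq> 0 \<longrightarrow> heap s' b = heap s b" "hout s' = hout s"
proof -
  define I where "I = (\<lambda>i (t :: store). hin t = concat (map (\<lambda>i. map (a i) [0..<n]) [i..<n]) \<and>
    (\<forall>k<i. \<forall>j<n. heap t 0 k j = a k j) \<and> (\<forall>b. b \<noteq> 0 \<longrightarrow> heap t b = heap s b) \<and> hout t = hout s)"
  have "I n s'"
    unfolding s'_def read_matrix_def sem.simps
  proof (rule fold_upt_induct)
    show "I 0 s" using assms by (simp add: I_def)
    fix i t assume i: "i < n" and It: "I i t"
    define rest where "rest = concat (map (\<lambda>i. map (a i) [0..<n]) [Suc i..<n])"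
    define J where "J = (\<lambda>m (u :: store). hin u = map (a i) [m..<n] @ rest \<and>
      (\<forall>k<i. \<forall>j<n. heap u 0 k j = a k j) \<and> (\<forall>j<m. heap u 0 i j = a i j) \<and>
      (\<forall>b. b \<noteq> 0 \<longrightarrow> heap u b = heap s b) \<and> hout u = hout s)"
    let ?e = "e(5 := i)"
    have "J n (fold (\<lambda>k s. (put 0 ((?e(2 := k)) 5) ((?e(2 := k)) 2)
        (case hin s of [] \<Rightarrow> 0 | x # _ \<Rightarrow> x) s)\<lparr>hin := tl (hin s)\<rparr>) [0..<n] t)"
    proof (rule fold_upt_induct)
      show "J 0 t" using It i by (simp add: I_def J_def rest_def upt_conv_Cons)
    next
      fix m u assume "m < n" "J m u"
      then show "J (Suc m) ((put 0 ((?e(2 := m)) 5) ((?e(2 := m)) 2)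
        (case hin u of [] \<Rightarrow> 0 | x # _ \<Rightarrow> x) u)\<lparr>hin := tl (hin u)\<rparr>)"
        by (auto simp: J_def upt_conv_Cons less_Suc_eq)
    qed
    then show "I (Suc i) (fold (\<lambda>k s. (put 0 ((?e(2 := k)) 5) ((?e(2 := k)) 2)
        (case hin s of [] \<Rightarrow> 0 | x # _ \<Rightarrow> x) s)\<lparr>hin := tl (hin s)\<rparr>) [0..<n] t)"
      unfolding I_def J_def rest_def by (auto simp: less_Suc_eq)
  qed
  then show "\<forall>i<n. \<forall>j<n. heap s' 0 i j = a i j" "\<forall>b. b \<noteq> 0 \<longrightarrow> heap s' b = heap s b" "hout s' = hout s"
    by (simp_all add: I_def)
qed

lemma start_row_correct:
  fixes n :: nat and e :: "nat \<Rightarrow> nat" and s :: store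
  assumes "e 0 = 0"
  defines "s' \<equiv> sem n start_row e s"
  shows "same_except {3, 4} s s'"
    "\<forall>j<n. pos s' 3 0 j \<longleftrightarrow> pos s 0 (e 5) j"
    "\<forall>j<n. pos s' 4 0 j \<longleftrightarrow> j = e 5"
    "pos s' 4 0 (e 5)"
proof -
  define I where "I = (\<lambda>m (t :: store). same_except {3, 4} s t \<and> (\<forall>j<m. pos t 3 0 j \<longleftrightarrow> pos s 0 (e 5) j) \<and>
    (\<forall>j<m. heap t 4 0 j = 0))"
  define t where "t = sem n (For 2 (Seq (copy 3 0 2 0 5 2) (Assign 4 0 2 0))) e s"
  have "I n t"
    unfolding t_def sem.simps
    by (rule fold_upt_induct)
      (use assms(1) in \<open>auto simp: I_def same_except_def sem_copy less_Suc_eq\<close>)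
  moreover have "s' = put 4 0 (e 5) 1 t"
    by (simp add: s'_def start_row_def t_def assms)
  ultimately show "same_except {3, 4} s s'" "\<forall>j<n. pos s' 3 0 j \<longleftrightarrow> pos s 0 (e 5) j"
    "\<forall>j<n. pos s' 4 0 j \<longleftrightarrow> j = e 5" "pos s' 4 0 (e 5)"
    by (auto simp: I_def same_except_def)
qed

lemma add_row_correct:
  fixes n :: nat and e :: "nat \<Rightarrow> nat" and s :: store
  assumes "e 0 = 0"
  defines "s' \<equiv> sem n add_row e s"
  shows "same_except {3, 4} s s'"
    "\<forall>j<n. pos s' 3 0 j \<longleftrightarrow> pos s 3 0 j \<noteq> pos s 9 (e 3) j"
    "\<forall>j<n. pos s' 4 0 j \<longleftrightarrow> pos s 4 0 j \<noteq> pos s 2 (e 3) j"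
proof -
  define I where "I = (\<lambda>m (t :: store). same_except {3, 4} s t \<and>
    (\<forall>j. pos t 3 0 j \<longleftrightarrow> (if j < m then pos s 3 0 j \<noteq> pos s 9 (e 3) j else pos s 3 0 j)) \<and>
    (\<forall>j. pos t 4 0 j \<longleftrightarrow> (if j < m then pos s 4 0 j \<noteq> pos s 2 (e 3) j else pos s 4 0 j)))"
  have "I n s'"
    unfolding s'_def add_row_def sem.simps
  proof (rule fold_upt_induct)
    show "I 0 s" by (simp add: I_def same_except_def)
  next
    fix m t assume It: "I m t"
    have *: "heap t 9 = heap s 9" "heap t 2 = heap s 2"
      using It by (auto simp: I_def same_except_def)
    define u where "u = (if pos t 9 (e 3) m then put 3 0 m (if pos t 3 0 m then 0 else 1) t else t)"
    define v where "v = (if pos u 2 (e 3) m then put 4 0 m (if pos u 4 0 m then 0 else 1) u else u)"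
    have u: "pos u 3 0 j \<longleftrightarrow> (if j = m \<and> pos s 9 (e 3) m then \<not> pos t 3 0 j else pos t 3 0 j)"
      "heap u 4 = heap t 4" "heap u 2 = heap s 2" for j
      by (auto simp: u_def *)
    have v: "pos v 4 0 j \<longleftrightarrow> (if j = m \<and> pos s 2 (e 3) m then \<not> pos t 4 0 j else pos t 4 0 j)"
      "heap v 3 = heap u 3" for j
      by (auto simp: v_def u(2,3))
    have "same_except {3, 4} s v"
      using It by (auto simp: I_def same_except_def v_def u_def)
    then have "I (Suc m) v"
      using It by (auto simp: I_def u v less_Suc_eq)
    moreover have "sem n (IfPos 2 3 2 (toggle 4 0 2) Skip) (e(2 := m))
        (sem n (IfPos 9 3 2 (toggle 3 0 2) Skip) (e(2 := m)) t) = v"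
      using assms(1) by (simp add: v_def u_def sem_toggle)
    ultimately show "I (Suc m)
        (if 0 < heap (if 0 < heap t 9 ((e(2 := m)) 3) ((e(2 := m)) 2) then sem n (toggle 3 0 2) (e(2 := m)) t else t) 2
                 ((e(2 := m)) 3) ((e(2 := m)) 2)
         then sem n (toggle 4 0 2) (e(2 := m))
               (if 0 < heap t 9 ((e(2 := m)) 3) ((e(2 := m)) 2) then sem n (toggle 3 0 2) (e(2 := m)) t else t)
         else if 0 < heap t 9 ((e(2 := m)) 3) ((e(2 := m)) 2) then sem n (toggle 3 0 2) (e(2 := m)) t else t)"
      by (simp only: sem.simps)
  qed
  then show "same_except {3, 4} s s'"
    "\<forall>j<n. pos s' 3 0 j \<longleftrightarrow> pos s 3 0 j \<noteq> pos s 9 (e 3) j"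
    "\<forall>j<n. pos s' 4 0 j \<longleftrightarrow> pos s 4 0 j \<noteq> pos s 2 (e 3) j"
    by (auto simp: I_def)
qed

lemma find_pivot_correct:
  fixes n :: nat and e :: "nat \<Rightarrow> nat" and s :: store
  assumes "e 0 = 0"
  defines "s' \<equiv> sem n find_pivot e s"
  shows "same_except {5, 8} s s'"
    "\<forall>k. k \<noteq> e 5 \<longrightarrow> heap s' 5 0 k = heap s 5 0 k"
    "pos s' 8 0 0 \<longleftrightarrow> (\<exists>j<n. pos s 3 0 j)"
    "pos s' 8 0 0 \<Longrightarrow> heap s' 5 0 (e 5) < n \<and> pos s 3 0 (heap s' 5 0 (e 5))"
proof -
  define I where "I = (\<lambda>m (t :: store). same_except {5, 8} s t \<and>
    (\<forall>k. k \<noteq> e 5 \<longrightarrow> heap t 5 0 k = heap s 5 0 k) \<and>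
    (pos t 8 0 0 \<longleftrightarrow> (\<exists>j<m. pos s 3 0 j)) \<and>
    (pos t 8 0 0 \<longrightarrow> heap t 5 0 (e 5) < m \<and> pos s 3 0 (heap t 5 0 (e 5))))"
  have "I n s'"
    unfolding s'_def find_pivot_def sem.simps
  proof (rule fold_upt_induct)
    fix m t assume It: "I m t"
    have *: "heap t 3 = heap s 3"
      using It by (auto simp: I_def same_except_def)
    show "I (Suc m) (if 0 < heap t 3 ((e(2 := m)) 0) ((e(2 := m)) 2)
        then put 5 ((e(2 := m)) 0) ((e(2 := m)) 5) ((e(2 := m)) 2)
          (put 8 ((e(2 := m)) 0) ((e(2 := m)) 0) 1 t) else t)"
      using It assms(1) by (auto simp: I_def same_except_def * less_Suc_eq)
  qed (use assms(1) in \<open>auto simp: I_def same_except_def\<close>)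
  then show "same_except {5, 8} s s'"
    "\<forall>k. k \<noteq> e 5 \<longrightarrow> heap s' 5 0 k = heap s 5 0 k"
    "pos s' 8 0 0 \<longleftrightarrow> (\<exists>j<n. pos s 3 0 j)"
    "pos s' 8 0 0 \<Longrightarrow> heap s' 5 0 (e 5) < n \<and> pos s 3 0 (heap s' 5 0 (e 5))"
    by (simp_all add: I_def)
qed

lemma save_row_correct:
  fixes n :: nat and e :: "nat \<Rightarrow> nat" and s :: store
  assumes "e 0 = 0"
  defines "s' \<equiv> sem n save_row e s"
  shows "same_except {9, 2} s s'"
    "\<forall>k. k \<noteq> e 5 \<longrightarrow> heap s' 9 k = heap s 9 k \<and> heap s' 2 k = heap s 2 k"
    "\<forall>j<n. pos s' 9 (e 5) j \<longleftrightarrow> pos s 3 0 j"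
    "\<forall>j<n. pos s' 2 (e 5) j \<longleftrightarrow> pos s 4 0 j"
proof -
  define I where "I = (\<lambda>m (t :: store). same_except {9, 2} s t \<and>
    (\<forall>k. k \<noteq> e 5 \<longrightarrow> heap t 9 k = heap s 9 k \<and> heap t 2 k = heap s 2 k) \<and>
    (\<forall>j<m. pos t 9 (e 5) j \<longleftrightarrow> pos s 3 0 j) \<and> (\<forall>j<m. pos t 2 (e 5) j \<longleftrightarrow> pos s 4 0 j))"
  have "I n s'"
    unfolding s'_def save_row_def sem.simps
  proof (rule fold_upt_induct)
    show "I 0 s" by (simp add: I_def same_except_def)
  next
    fix m t assume It: "I m t"
    have *: "heap t 3 = heap s 3" "heap t 4 = heap s 4"
      using It by (auto simp: I_def same_except_def)
    show "I (Suc m) (sem n (copy 2 5 2 4 0 2) (e(2 := m)) (sem n (copy 9 5 2 3 0 2) (e(2 := m)) t))"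
      using It assms(1) by (auto simp: I_def same_except_def sem_copy * less_Suc_eq fun_eq_iff)
  qed
  then show "same_except {9, 2} s s'"
    "\<forall>k. k \<noteq> e 5 \<longrightarrow> heap s' 9 k = heap s 9 k \<and> heap s' 2 k = heap s 2 k"
    "\<forall>j<n. pos s' 9 (e 5) j \<longleftrightarrow> pos s 3 0 j"
    "\<forall>j<n. pos s' 2 (e 5) j \<longleftrightarrow> pos s 4 0 j"
    by (simp_all add: I_def)
qed

lemma prefix_parity_Suc:
  "prefix_parity a d i (Suc j) \<longleftrightarrow> prefix_parity a d i j \<noteq> (d j \<and> a i j)"
  by (auto simp: prefix_parity_def)

lemma compute_parities_correct:
  fixes n :: nat and e :: "nat \<Rightarrow> nat" and s :: store
  assumes e: "e 0 = 0" and a: "\<forall>i<n. \<forall>j<n. pos s 0 i j \<longleftrightarrow> a i j"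
  defines "s' \<equiv> sem n compute_parities e s"
  shows "same_except {6, 8} s s'"
    "\<forall>i<n. \<forall>j<n. pos s' 6 i j \<longleftrightarrow> prefix_parity a (pos s 4 0) i j"
proof -
  let ?p = "prefix_parity a (pos s 4 0)"
  define I where "I = (\<lambda>m (t :: store). same_except {6, 8} s t \<and> (\<forall>i<m. \<forall>j<n. pos t 6 i j \<longleftrightarrow> ?p i j))"
  have "I n s'"
    unfolding s'_def compute_parities_def sem.simps(8)[of n 5]
  proof (rule fold_upt_induct)
    show "I 0 s" by (simp add: I_def same_except_def)
  next
    fix i t assume i: "i < n" and It: "I i t"
    \<comment> \<open>The flag in array 8 holds the parity for column \<open>m\<close>, the next one
      to be written.\<close>
    define J where "J = (\<lambda>m (u :: store). same_except {6, 8} s u \<and>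
      (\<forall>k<i. \<forall>j<n. pos u 6 k j \<longleftrightarrow> ?p k j) \<and>
      (\<forall>j<m. pos u 6 i j \<longleftrightarrow> ?p i j) \<and> (pos u 8 0 0 \<longleftrightarrow> ?p i m))"
    let ?c = "Seq (copy 6 5 2 8 0 0) (IfPos 4 0 2 (IfPos 0 5 2 (toggle 8 0 0) Skip) Skip)"
    have "J n (fold (\<lambda>k. sem n ?c (e(5 := i, 2 := k))) [0..<n] (put 8 0 0 0 t))"
    proof (rule fold_upt_induct)
      show "J 0 (put 8 0 0 0 t)"
        using It by (auto simp: I_def J_def same_except_def prefix_parity_def)
    next
      fix m u assume m: "m < n" and Ju: "J m u"
      have *: "heap u 4 = heap s 4" "heap u 0 = heap s 0"
        using Ju by (auto simp: J_def same_except_def)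
      have "sem n ?c (e(5 := i, 2 := m)) u =
        (let v = put 6 i m (of_bool (pos u 8 0 0)) u in
         if pos s 4 0 m \<and> a i m then put 8 0 0 (if pos u 8 0 0 then 0 else 1) v else v)"
        using e a i m by (simp add: sem_copy sem_toggle Let_def *)
      then show "J (Suc m) (sem n ?c (e(5 := i, 2 := m)) u)"
        using Ju by (auto simp: J_def same_except_def Let_def prefix_parity_Suc less_Suc_eq)
    qed
    moreover have "sem n (Seq (Assign 8 0 0 0) (For 2 ?c)) (e(5 := i)) t =
        fold (\<lambda>k. sem n ?c (e(5 := i, 2 := k))) [0..<n] (put 8 0 0 0 t)"
      using e by (subst sem.simps(6)) (simp del: sem.simps(6,7))
    ultimately show "I (Suc i) (sem n (Seq (Assign 8 0 0 0) (For 2 ?c)) (e(5 := i)) t)"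
      by (simp add: I_def J_def less_Suc_eq all_conj_distrib del: sem.simps)
  qed
  then show "same_except {6, 8} s s'" "\<forall>i<n. \<forall>j<n. pos s' 6 i j \<longleftrightarrow> ?p i j"
    by (auto simp: I_def)
qed

lemma print_signing_correct:
  assumes e: "e 0 = 0" and p: "\<forall>i<n. \<forall>j<n. pos s 6 i j \<longleftrightarrow> prefix_parity a (pos s 4 0) i j"
  shows "hout (sem n print_signing e s) = hout s @
    concat (map (\<lambda>i. map (alternating_sign a (pos s 4 0) i) [0..<n]) [0..<n])"
proof -
  let ?f = "alternating_sign a (pos s 4 0)"
  define I where "I = (\<lambda>m (t :: store). heap t = heap s \<and>
    hout t = hout s @ concat (map (\<lambda>i. map (?f i) [0..<n]) [0..<m]))"
  have "I n (sem n print_signing e s)"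
    unfolding print_signing_def sem.simps(8)[of n 5]
  proof (rule fold_upt_induct)
    show "I 0 s" by (simp add: I_def)
  next
    fix i t assume i: "i < n" and It: "I i t"
    define J where "J = (\<lambda>m (u :: store). heap u = heap s \<and> hout u = hout t @ map (?f i) [0..<m])"
    let ?c = "IfPos 4 0 2 (IfPos 6 5 2 (Output (-1)) (Output 1))
       (IfPos 4 0 5 (IfPos 6 2 5 (Output (-1)) (Output 1)) (Output 1))"
    have "J n (fold (\<lambda>k. sem n ?c (e(5 := i, 2 := k))) [0..<n] t)"
    proof (rule fold_upt_induct)
      show "J 0 t" using It by (simp add: I_def J_def)
    next
      fix m u assume m: "m < n" and Ju: "J m u"
      then have "sem n ?c (e(5 := i, 2 := m)) u = u\<lparr>hout := hout u @ [?f i m]\<rparr>"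
        using e p i by (simp add: J_def alternating_sign_def)
      then show "J (Suc m) (sem n ?c (e(5 := i, 2 := m)) u)"
        using Ju by (simp add: J_def)
    qed
    then show "I (Suc i) (sem n (For 2 ?c) (e(5 := i)) t)"
      using It by (simp add: I_def J_def del: sem.simps(7))
  qed
  then show ?thesis by (simp add: I_def)
qed

section \<open>Invariant of the elimination\<close>

text \<open>An echelon form up to the order of the columns. Two clauses support the program:
  unfilled slots are zero because reduction scans them too, and the set of row \<open>k\<close>
  stays within indices up to \<open>k\<close>, so that adding it to a later row cannot remove that
  row from its own set.\<close>

definition reduced :: "nat \<Rightarrow> (nat \<Rightarrow> nat \<Rightarrow> bool) \<Rightarrow> nat set \<Rightarrow> nat \<Rightarrow> store \<Rightarrow> bool" where
  "reduced n a X r s \<longleftrightarrow>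
     (\<forall>k j. r \<le> k \<longrightarrow> k < n \<longrightarrow> j < n \<longrightarrow> \<not> pos s 9 k j \<and> \<not> pos s 2 k j) \<and>
     (\<forall>k<r. consistent_row n a X (pos s 9 k) (pos s 2 k) \<and>
        heap s 5 0 k < n \<and> pos s 9 k (heap s 5 0 k) \<and>
        (\<forall>k'<k. \<not> pos s 9 k (heap s 5 0 k')) \<and> (\<forall>i<n. pos s 2 k i \<longrightarrow> i \<le> k))"

text \<open>Going through the pivots in order suffices: row \<open>m\<close> is zero at earlier
  pivots, so clearing its own pivot column does not spoil those already cleared.\<close>

lemma reduce_row_correct:
  fixes n :: nat and e :: "nat \<Rightarrow> nat" and s :: store
  assumes e: "e 0 = 0" and red: "reduced n a X r s" and r: "r < n"
    and cons: "consistent_row n a X (pos s 3 0) (pos s 4 0)"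
    and d: "pos s 4 0 r" "\<forall>i<n. pos s 4 0 i \<longrightarrow> i \<le> r"
  defines "s' \<equiv> sem n reduce_row e s"
  shows "same_except {3, 4} s s'" "consistent_row n a X (pos s' 3 0) (pos s' 4 0)"
    "pos s' 4 0 r" "\<forall>i<n. pos s' 4 0 i \<longrightarrow> i \<le> r"
    "\<forall>k<r. \<not> pos s' 3 0 (heap s 5 0 k)"
proof -
  define I where "I = (\<lambda>m (t :: store). same_except {3, 4} s t \<and>
    consistent_row n a X (pos t 3 0) (pos t 4 0) \<and> pos t 4 0 r \<and>
    (\<forall>i<n. pos t 4 0 i \<longrightarrow> i \<le> r) \<and> (\<forall>k<r. k < m \<longrightarrow> \<not> pos t 3 0 (heap s 5 0 k)))"
  have "I n s'"
    unfolding s'_def reduce_row_def sem.simps(8)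
  proof (rule fold_upt_induct)
    show "I 0 s" using cons d by (simp add: I_def same_except_def)
  next
    fix m t assume m: "m < n" and It: "I m t"
    have same: "same_except {3, 4} s t" and cons_t: "consistent_row n a X (pos t 3 0) (pos t 4 0)"
      and dt: "pos t 4 0 r" "\<And>i. i < n \<Longrightarrow> pos t 4 0 i \<Longrightarrow> i \<le> r"
      and piv: "\<And>k. k < r \<Longrightarrow> k < m \<Longrightarrow> \<not> pos t 3 0 (heap s 5 0 k)"
      using It by (simp_all add: I_def)
    have *: "heap t 9 = heap s 9" "heap t 2 = heap s 2" "heap t 5 = heap s 5"
      using same by (simp_all add: same_except_def)
    define p where "p = heap s 5 0 m"
    let ?e = "e(3 := m, 4 := p)"
    define u where "u = sem n add_row ?e t"
    have step: "sem n (Let 4 5 0 3 (IfPos 3 0 4 add_row Skip)) (e(3 := m)) t =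
        (if pos t 3 0 p then u else t)"
      using e by (simp add: u_def p_def *)
    have u: "same_except {3, 4} t u"
      "\<And>j. j < n \<Longrightarrow> pos u 3 0 j \<longleftrightarrow> pos t 3 0 j \<noteq> pos s 9 m j"
      "\<And>j. j < n \<Longrightarrow> pos u 4 0 j \<longleftrightarrow> pos t 4 0 j \<noteq> pos s 2 m j"
      using add_row_correct[where e = ?e and n = n and s = t] e by (simp_all add: u_def *)
    show "I (Suc m) (sem n (Let 4 5 0 3 (IfPos 3 0 4 add_row Skip)) (e(3 := m)) t)"
    proof (cases "pos t 3 0 p")
      case False
      then show ?thesis
        unfolding step using It by (auto simp: I_def p_def less_Suc_eq)
    next
      case p: True
      have same_u: "same_except {3, 4} s u"
        using u(1) same by (simp add: same_except_def)
      show ?thesis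
      proof (cases "m < r")
        case True
        have row: "consistent_row n a X (pos s 9 m) (pos s 2 m)" "p < n" "pos s 9 m p"
          "\<And>k. k < m \<Longrightarrow> \<not> pos s 9 m (heap s 5 0 k)" "\<And>i. i < n \<Longrightarrow> pos s 2 m i \<Longrightarrow> i \<le> m"
          using red True unfolding reduced_def p_def by blast+
        have pn: "heap s 5 0 k < n" if "k < r" for k
          using red that unfolding reduced_def by blast
        \<comment> \<open>Both rows contain the pivot column \<open>p\<close>, which is the shared
          column that the addition of consistent rows requires.\<close>
        have "consistent_row n a X (pos u 3 0) (pos u 4 0)"
          by (rule consistent_row_cong[OF consistent_row_xor[OF cons_t row(1,2) p row(3)]])
            (use u in auto)
        \<comment> \<open>The set of row \<open>m\<close> reaches only up to \<open>m < r\<close>,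
          so \<open>r\<close> survives the symmetric difference.\<close>
        moreover have "pos u 4 0 r" using u(3)[OF r] dt(1) row(5)[OF r] True by auto
        moreover have "i \<le> r" if "i < n" "pos u 4 0 i" for i
          using u(3)[OF that(1)] dt(2)[OF that(1)] row(5)[OF that(1)] True that(2) by linarith
        \<comment> \<open>At \<open>p\<close> the two entries cancel; at an earlier pivot both rows
          are zero.\<close>
        moreover have "\<not> pos u 3 0 (heap s 5 0 k)" if "k < r" "k < Suc m" for k
        proof (cases "k = m")
          case True
          then show ?thesis using u(2)[OF row(2)] p row(3) by (simp add: p_def)
        next
          case False
          then have "k < m" using that by simp
          then show ?thesis using u(2)[OF pn] that piv row(4) by simp
        qed
        ultimately show ?thesis
          unfolding step using p same_u by (simp add: I_def)
      next
        case False
        \<comment> \<open>An unfilled slot: whatever its pivot cell contains, the row that may be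
          added is zero.\<close>
        then have zero: "\<not> pos s 9 m j \<and> \<not> pos s 2 m j" if "j < n" for j
          using red m that unfolding reduced_def by (metis not_le_imp_less)
        have u': "pos u 3 0 j \<longleftrightarrow> pos t 3 0 j" "pos u 4 0 j \<longleftrightarrow> pos t 4 0 j" if "j < n" for j
          using u(2,3) zero that by simp_all
        have pn: "heap s 5 0 k < n" if "k < r" for k
          using red that unfolding reduced_def by blast
        have "consistent_row n a X (pos u 3 0) (pos u 4 0)"
          by (rule consistent_row_cong[OF cons_t]) (use u' in auto)
        moreover have "pos u 4 0 r" using u'(2)[OF r] dt(1) by simp
        moreover have "i \<le> r" if "i < n" "pos u 4 0 i" for i
          using u'(2) dt(2) that by simp
        moreover have "\<not> pos u 3 0 (heap s 5 0 k)" if "k < r" for k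
          using u'(1)[OF pn] piv that False by simp
        ultimately show ?thesis
          unfolding step using p same_u by (simp add: I_def)
      qed
    qed
  qed
  then show "same_except {3, 4} s s'" "consistent_row n a X (pos s' 3 0) (pos s' 4 0)"
    "pos s' 4 0 r" "\<forall>i<n. pos s' 4 0 i \<longrightarrow> i \<le> r"
    "\<forall>k<r. \<not> pos s' 3 0 (heap s 5 0 k)"
    using r by (simp_all add: I_def)
qed

lemma reduced_cong:
  "reduced n a X r s \<Longrightarrow> heap s' 9 = heap s 9 \<Longrightarrow> heap s' 2 = heap s 2 \<Longrightarrow>
    \<forall>k<r. heap s' 5 0 k = heap s 5 0 k \<Longrightarrow> reduced n a X r s'"
  by (simp add: reduced_def)

lemma reduced_Suc:
  assumes red: "reduced n a X r s" and "r < n"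
    and rows: "\<forall>k. k \<noteq> r \<longrightarrow> heap s' 9 k = heap s 9 k \<and> heap s' 2 k = heap s 2 k"
    and piv: "\<forall>k. k \<noteq> r \<longrightarrow> heap s' 5 0 k = heap s 5 0 k"
    and new: "consistent_row n a X (pos s' 9 r) (pos s' 2 r)" "heap s' 5 0 r < n"
      "pos s' 9 r (heap s' 5 0 r)" "\<forall>k<r. \<not> pos s' 9 r (heap s 5 0 k)"
      "\<forall>i<n. pos s' 2 r i \<longrightarrow> i \<le> r"
  shows "reduced n a X (Suc r) s'"
proof -
  have "\<not> pos s' 9 k j \<and> \<not> pos s' 2 k j" if "Suc r \<le> k" "k < n" "j < n" for k j
    using red rows that unfolding reduced_def by simp
  moreover have "consistent_row n a X (pos s' 9 k) (pos s' 2 k) \<and>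
        heap s' 5 0 k < n \<and> pos s' 9 k (heap s' 5 0 k) \<and>
        (\<forall>k'<k. \<not> pos s' 9 k (heap s' 5 0 k')) \<and> (\<forall>i<n. pos s' 2 k i \<longrightarrow> i \<le> k)" if "k < Suc r" for k
  proof (cases "k = r")
    case True
    then show ?thesis using new piv by simp
  next
    case False
    then have k: "k < r" using that by simp
    then have "heap s' 9 k = heap s 9 k" "heap s' 2 k = heap s 2 k" "heap s' 5 0 k = heap s 5 0 k"
      using rows piv by auto
    moreover have "heap s' 5 0 k' = heap s 5 0 k'" if "k' < k" for k'
      using k that piv by simp
    ultimately show ?thesis using red k unfolding reduced_def by simp
  qed
  ultimately show ?thesis unfolding reduced_def by blast
qed

text \<open>The two outcomes are exactly the hypotheses of the two halves of the mathematics: a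
  nonempty dependent set on one side, or \<open>n\<close> triangular rows.\<close>

lemma eliminate_correct:
  fixes n :: nat and e :: "nat \<Rightarrow> nat" and s :: store
  assumes e: "e 0 = 0" and a: "\<forall>i<n. \<forall>j<n. pos s 0 i j \<longleftrightarrow> a i j"
    and zero: "\<forall>b. b \<noteq> 0 \<longrightarrow> heap s b = (\<lambda>_ _. 0)"
    and bip: "\<And>i j. i < n \<Longrightarrow> j < n \<Longrightarrow> a i j \<Longrightarrow> (i \<in> X) \<noteq> (j \<in> X)"
  defines "s' \<equiv> sem n eliminate e s"
  shows "heap s' 0 = heap s 0" "hout s' = hout s"
    "if pos s' 7 0 0
     then (\<exists>r<n. pos s' 4 0 r) \<and> consistent_row n a X (\<lambda>_. False) (pos s' 4 0)
     else reduced n a X n s'"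
proof -
  \<comment> \<open>With the flag set, the claim does not depend on \<open>r\<close>, so idle rounds
    preserve it.\<close>
  define I where "I = (\<lambda>r (t :: store). heap t 0 = heap s 0 \<and> hout t = hout s \<and>
    (if pos t 7 0 0
     then (\<exists>r<n. pos t 4 0 r) \<and> consistent_row n a X (\<lambda>_. False) (pos t 4 0)
     else reduced n a X r t))"
  have "I n s'"
    unfolding s'_def eliminate_def sem.simps(8)[of n 5]
  proof (rule fold_upt_induct)
    show "I 0 s" using zero by (simp add: I_def reduced_def)
  next
    fix r t assume r: "r < n" and It: "I r t"
    let ?e = "e(5 := r)"
    have e': "?e 0 = 0" using e by simp
    define t1 where "t1 = sem n start_row ?e t"
    define t2 where "t2 = sem n reduce_row ?e t1"
    define t3 where "t3 = sem n find_pivot ?e t2"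
    define t4 where "t4 = (if pos t3 8 0 0 then sem n save_row ?e t3 else put 7 0 0 1 t3)"
    have sem_eq: "sem n (IfPos 7 0 0 Skip (Seq start_row (Seq reduce_row
        (Seq find_pivot (IfPos 8 0 0 save_row (Assign 7 0 0 1)))))) ?e t = (if pos t 7 0 0 then t else t4)"
      using e by (simp add: t1_def t2_def t3_def t4_def)
    show "I (Suc r) (sem n (IfPos 7 0 0 Skip (Seq start_row (Seq reduce_row
        (Seq find_pivot (IfPos 8 0 0 save_row (Assign 7 0 0 1)))))) ?e t)"
    proof (cases "pos t 7 0 0")
      case True
      then show ?thesis unfolding sem_eq using It by (simp add: I_def)
    next
      case False
      then have red: "reduced n a X r t" and t0: "heap t 0 = heap s 0" "hout t = hout s"
        using It by (simp_all add: I_def)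
      note start = start_row_correct[where e = ?e and n = n and s = t, OF e', folded t1_def]
      have same1: "same_except {3, 4} t t1" by (rule start(1))
      have T1: "pos t1 3 0 j \<longleftrightarrow> a r j" if "j < n" for j
        using start(2) t0 a r that by simp
      have D1: "pos t1 4 0 j \<longleftrightarrow> j = r" if "j < n" for j
        using start(3) that by simp
      have red1: "reduced n a X r t1"
        by (rule reduced_cong[OF red]) (use same1 in \<open>auto simp: same_except_def\<close>)
      have cons1: "consistent_row n a X (pos t1 3 0) (pos t1 4 0)"
        by (rule consistent_row_cong[OF consistent_row_single[OF r]]) (use bip T1 D1 in auto)
      have D1r: "pos t1 4 0 r" "\<forall>i<n. pos t1 4 0 i \<longrightarrow> i \<le> r" using D1 r by auto
      note reduce = reduce_row_correct[where e = ?e, OF e' red1 r cons1 D1r, folded t2_def]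
      note pivot = find_pivot_correct[where e = ?e and n = n and s = t2, OF e', folded t3_def]
      have h3: "heap t3 b = heap t b" if "b \<notin> {3, 4, 5, 8}" for b
        using that same1 reduce(1) pivot(1) by (simp add: same_except_def)
      have h34: "heap t3 3 = heap t2 3" "heap t3 4 = heap t2 4"
        using pivot(1) by (simp_all add: same_except_def)
      have h5: "heap t2 5 = heap t 5" "heap t1 5 = heap t 5"
        using same1 reduce(1) by (simp_all add: same_except_def)
      have p5: "heap t3 5 0 k = heap t 5 0 k" if "k \<noteq> r" for k
        using pivot(2) that h5 by simp
      have out3: "hout t3 = hout t"
        using same1 reduce(1) pivot(1) by (simp add: same_except_def)
      show ?thesis
      proof (cases "pos t3 8 0 0")
        case True
        have t4: "t4 = sem n save_row ?e t3" using True by (simp add: t4_def)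
        note save = save_row_correct[where e = ?e and n = n and s = t3, OF e', folded t4]
        have h4: "heap t4 b = heap t3 b" if "b \<notin> {9, 2}" for b
          using save(1) that by (simp add: same_except_def)
        have W: "pos t4 9 r j \<longleftrightarrow> pos t2 3 0 j" "pos t4 2 r j \<longleftrightarrow> pos t2 4 0 j" if "j < n" for j
          using save(3,4) that h34 by simp_all
        have p: "heap t4 5 0 r < n" "pos t2 3 0 (heap t4 5 0 r)"
          using pivot(4)[OF True] h4[of 5] by simp_all
        have "reduced n a X (Suc r) t4"
        proof (rule reduced_Suc[OF red r])
          show "\<forall>k. k \<noteq> r \<longrightarrow> heap t4 9 k = heap t 9 k \<and> heap t4 2 k = heap t 2 k"
            using save(2) h3 by simp
          show "\<forall>k. k \<noteq> r \<longrightarrow> heap t4 5 0 k = heap t 5 0 k"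
            using p5 h4[of 5] by simp
          show "consistent_row n a X (pos t4 9 r) (pos t4 2 r)"
            by (rule consistent_row_cong[OF reduce(2)]) (use W in auto)
          show "heap t4 5 0 r < n" by (rule p)
          show "pos t4 9 r (heap t4 5 0 r)" using W(1)[OF p(1)] p(2) by simp
          show "\<forall>k<r. \<not> pos t4 9 r (heap t 5 0 k)"
          proof (intro allI impI)
            fix k assume k: "k < r"
            then have "heap t 5 0 k < n" using red unfolding reduced_def by blast
            then show "\<not> pos t4 9 r (heap t 5 0 k)"
              using W(1) reduce(5) h5 k by simp
          qed
          show "\<forall>i<n. pos t4 2 r i \<longrightarrow> i \<le> r" using W(2) reduce(4) by simp
        qed
        moreover have "\<not> pos t4 7 0 0" "heap t4 0 = heap s 0" "hout t4 = hout s"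
          using False h4 h3 t0 out3 save(1) by (simp_all add: same_except_def)
        ultimately show ?thesis unfolding sem_eq using False by (simp add: I_def)
      next
        case none: False
        then have t4: "t4 = put 7 0 0 1 t3" by (simp add: t4_def)
        have "\<not> pos t2 3 0 j" if "j < n" for j
          using pivot(3) none that by metis
        then have "consistent_row n a X (\<lambda>_. False) (pos t2 4 0)"
          by (intro consistent_row_cong[OF reduce(2)]) auto
        \<comment> \<open>Row \<open>r\<close> itself never leaves the set in progress, so the
          vanishing combination is nonempty.\<close>
        moreover have "\<exists>r<n. pos t2 4 0 r" using reduce(3) r by blast
        ultimately show ?thesis
          unfolding sem_eq using False t0 h3 h34 out3 by (simp add: I_def t4)
      qed
    qed
  qed
  then show "heap s' 0 = heap s 0" "hout s' = hout s"
    "if pos s' 7 0 0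
     then (\<exists>r<n. pos s' 4 0 r) \<and> consistent_row n a X (\<lambda>_. False) (pos s' 4 0)
     else reduced n a X n s'"
    by (simp_all add: I_def)
qed

section \<open>Correctness of the whole program\<close>

lemma encode_mat_eq:
  "encode_mat (mat n n f) = concat (map (\<lambda>i. map (\<lambda>j. f (i, j)) [0..<n]) [0..<n])"
  unfolding encode_mat_def mat_to_list_def
  by (intro arg_cong[where f = concat] map_cong) auto

lemma signing_program_correct:
  assumes bipartite: "bipartite_graph n E"
    and s: "heap s = (\<lambda>_ _ _. 0)" "hout s = []"
      "hin s = concat (map (\<lambda>i. map (\<lambda>j. of_bool ({i, j} \<in> E)) [0..<n]) [0..<n])"
  defines "ys \<equiv> hout (sem n signing_program (\<lambda>_. 0) s)"
  shows "if \<exists>s. singular_signing n E s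
    then \<exists>s. singular_signing n E s \<and> ys = 1 # encode_mat s else ys = [0]"
proof -
  let ?e = "\<lambda>_. 0 :: nat"
  define a where "a = (\<lambda>i j. {i, j} \<in> E)"
  \<comment> \<open>The bipartition occurs in the analysis only; the program never computes
    it.\<close>
  obtain X Y where XY: "X \<union> Y = {0..<n}" "X \<inter> Y = {}" "\<And>d. d \<in> E \<Longrightarrow> \<exists>x\<in>X. \<exists>y\<in>Y. d = {x, y}"
    using bipartite unfolding bipartite_graph_def by metis
  have bip: "(i \<in> X) \<noteq> (j \<in> X)" if aij: "a i j" for i j
  proof -
    obtain x y where "x \<in> X" "y \<in> Y" "{i, j} = {x, y}"
      using XY(3)[of "{i, j}"] aij by (auto simp: a_def)
    then show ?thesis using XY(2) by (auto simp: doubleton_eq_iff)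
  qed
  define s1 where "s1 = sem n read_matrix ?e s"
  define s2 where "s2 = sem n eliminate ?e s1"
  define s3 where "s3 = sem n compute_parities ?e s2"
  have ys: "ys = hout (if pos s2 7 0 0
      then sem n print_signing ?e (s3\<lparr>hout := hout s3 @ [1]\<rparr>) else s2\<lparr>hout := hout s2 @ [0]\<rparr>)"
    unfolding ys_def signing_program_def by (simp add: s1_def s2_def s3_def)
  note read = read_matrix_correct[where e = ?e, OF s(3), folded s1_def]
  have a1: "\<forall>i<n. \<forall>j<n. pos s1 0 i j \<longleftrightarrow> a i j"
    using read(1) by (simp add: a_def)
  have zero1: "\<forall>b. b \<noteq> 0 \<longrightarrow> heap s1 b = (\<lambda>_ _. 0)" using read(2) s(1) by simp
  note elim = eliminate_correct[where e = ?e, OF refl a1 zero1 bip, folded s2_def]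
  show ?thesis
  proof (cases "pos s2 7 0 0")
    case True
    then obtain r where r: "r < n" "pos s2 4 0 r"
      and cons: "consistent_row n a X (\<lambda>_. False) (pos s2 4 0)"
      using elim(3) by auto
    let ?s = "mat n n (\<lambda>(i, j). alternating_sign a (pos s2 4 0) i j)"
    have sing: "singular_signing n E ?s"
      by (rule singular_signing_if_dependent[OF r cons]) (use bip in \<open>auto simp: a_def\<close>)
    have a2: "\<forall>i<n. \<forall>j<n. pos s2 0 i j \<longleftrightarrow> a i j" using a1 elim(1) by simp
    note par = compute_parities_correct[where e = ?e, OF refl a2, folded s3_def]
    have "hout s3 = []" "heap s3 4 = heap s2 4"
      using par(1) elim(2) read(3) s(2) by (simp_all add: same_except_def)
    moreover have "\<forall>i<n. \<forall>j<n. pos (s3\<lparr>hout := hout s3 @ [1]\<rparr>) 6 i j \<longleftrightarrow>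
        prefix_parity a (pos (s3\<lparr>hout := hout s3 @ [1]\<rparr>) 4 0) i j"
      using par(2) \<open>heap s3 4 = heap s2 4\<close> by simp
    note print_signing_correct[where e = ?e, OF refl this]
    ultimately have "ys = 1 # encode_mat ?s"
      using True by (simp add: ys encode_mat_eq)
    then show ?thesis using sing by auto
  next
    case False
    then have red: "reduced n a X n s2" using elim(3) by simp
    have "\<not> singular_signing n E t" for t
    proof (rule no_singular_signing_if_triangular[where w = "pos s2 9" and c = "pos s2 2" and a = a
          and p = "heap s2 5 0"])
      fix k j assume kj: "k < n" "j < n"
      then have "consistent_row n a X (pos s2 9 k) (pos s2 2 k)"
        using red unfolding reduced_def by blast
      then show "pos s2 9 k j = odd (\<Sum>i<n. of_bool (pos s2 2 k i \<and> a i j) :: nat)"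
        using kj unfolding consistent_row_def by blast
    next
      fix k assume "k < n"
      then show "heap s2 5 0 k < n" "pos s2 9 k (heap s2 5 0 k)"
        using red unfolding reduced_def by blast+
    next
      fix k k' assume "k < n" "k' < k"
      then show "\<not> pos s2 9 k (heap s2 5 0 k')"
        using red unfolding reduced_def by blast
    qed (simp add: a_def)
    moreover have "ys = [0]" using False elim(2) read(3) s(2) by (simp add: ys)
    ultimately show ?thesis by simp
  qed
qed

subsection \<open>Polynomial running time\<close>

text \<open>For a fixed command the nesting of loops is fixed, so the bound is built from
  polynomials by finitely many sums and products.\<close>

lemma time_bound_poly: "\<exists>p :: nat poly. \<forall>n. time_bound n c = poly p n"
proof -
  have "\<exists>p :: nat poly. \<forall>n. cell_bound n = poly p n"
  proof -
    have "cell_bound n = poly ([:30, 6:] * (2 * ([:32:] * [:1, 1:] * [:1, 1:] + [:32:] * [:1, 1:] + [:32:]) + 2)) n"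
      for n
      unfolding cell_bound_def step_bound_def value_bound_def by (simp add: algebra_simps)
    then show ?thesis by blast
  qed
  then obtain q :: "nat poly" where q: "\<And>n. cell_bound n = poly q n" by blast
  show ?thesis
  proof (induction c)
    case (Seq c d)
    then obtain p p' where "\<forall>n. time_bound n c = poly p n" "\<forall>n. time_bound n d = poly p' n" by blast
    then show ?case by (intro exI[of _ "p + p'"]) simp
  next
    case (IfPos a i j c d)
    then obtain p p' where "\<forall>n. time_bound n c = poly p n" "\<forall>n. time_bound n d = poly p' n" by blast
    then show ?case by (intro exI[of _ "q + (p + p')"]) (simp add: q)
  next
    case (For x c)
    then obtain p where "\<forall>n. time_bound n c = poly p n" by blast
    then show ?case by (intro exI[of _ "q + [:0, 1:] * (p + q)"]) (simp add: q)
  next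
    case (Let x a i j c)
    then obtain p where "\<forall>n. time_bound n c = poly p n" by blast
    then show ?case by (intro exI[of _ "q + p"]) (simp add: q)
  qed (auto simp: q)
qed

text \<open>Natural coefficients make the polynomial monotone, which allows passing from a bound in
  \<open>n\<close> to one in the input size.\<close>

lemma poly_nat_mono: "m \<le> n \<Longrightarrow> poly p m \<le> poly p (n :: nat)"
  by (induction p) (auto intro: add_mono mult_mono)

text \<open>The tape holds \<open>1 + n * n\<close> integers, and each counts at least 1, even a
  zero.\<close>

lemma size_le_input_size: "n \<le> input_size (encode_graph n E)"
proof -
  have "length xs \<le> input_size xs" for xs
  proof (induction xs)
    case (Cons x xs)
    then show ?case using one_le_int_size[of x] by (simp add: input_size_def)
  qed simp
  moreover have "n \<le> length (encode_graph n E)"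
  proof -
    have "length (encode_graph n E) = 1 + n * n"
      by (simp add: encode_graph_def Defs.adj_mat_def encode_mat_eq length_concat comp_def sum_list_triv)
    then show ?thesis by (cases n) auto
  qed
  ultimately show ?thesis using le_trans by blast
qed

lemma int_size_le_input_size: "int_size (int n) \<le> input_size (encode_graph n E)"
  by (simp add: input_size_def encode_graph_def)

lemma wf_signing_program: "wf_com {0} signing_program"
  by (simp add: signing_program_def read_matrix_def eliminate_def start_row_def reduce_row_def
      add_row_def find_pivot_def save_row_def compute_parities_def print_signing_def toggle_def copy_def)

theorem theorem2:
  shows "\<exists>(P :: program) (p :: nat poly). \<forall>(n :: nat) (E :: nat set set). bipartite_graph n E \<longrightarrow>
    (\<exists>ys. outputs_in_time P (encode_graph n E) ys (poly p (input_size (encode_graph n E))) \<and>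
      (if \<exists>s. singular_signing n E s
       then \<exists>s. singular_signing n E s \<and> ys = 1 # encode_mat s
       else ys = [0]))"
proof -
  \<comment> \<open>The prologue puts 1 into register 0 and the number of vertices into register 1;
    the compiled code therefore starts at position 2.\<close>
  define P where "P = [SetConst 0 1, Read 1] @ compile 2 signing_program"
  obtain q :: "nat poly" where q: "\<And>n. time_bound n signing_program = poly q n"
    using time_bound_poly by metis
  \<comment> \<open>The constant 1 pays for setting register 0, and the linear term pays for reading
    \<open>n\<close>, whose size is at most the input size.\<close>
  define p where "p = q + [:1, 1:]"
  show ?thesis
  proof (intro exI[of _ P] exI[of _ p] allI impI)
    fix n E assume bip: "bipartite_graph n E"
    define rest :: "nat list" where "rest = concat (map (\<lambda>i. map (\<lambda>j. of_bool ({i, j} \<in> E)) [0..<n]) [0..<n]) "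
    define s where "s = \<lparr>heap = (\<lambda>_ _ _. 0), hin = rest, hout = []\<rparr>"
    define \<sigma> where "\<sigma> = \<lparr>pc = 2, reg = (\<lambda>_. 0)(0 := 1, 1 := int n), inp = map int rest, outp = []\<rparr>"
    define ys where "ys = hout (sem n signing_program (\<lambda>_. 0) s)"
    have input: "encode_graph n E = int n # map int rest"
      by (simp add: encode_graph_def Defs.adj_mat_def encode_mat_eq rest_def map_concat comp_def of_bool_def if_distrib
        cong: if_cong)
    have start: "run_within P (init_config (encode_graph n E)) (1 + (int_size (int n) + 0)) \<sigma>"
      apply (rule run_within_step[where ins = "SetConst 0 1"])
          apply (simp_all add: P_def init_config_def)[3]
       apply (simp add: int_size_def floorlog_def)
      apply (rule run_within_step[where ins = "Read 1"])
          apply (simp_all add: P_def input)[3]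
       apply (simp add: input)
      apply (rule run_within_eq)
         apply (simp_all add: \<sigma>_def input)
      done
    have small: "\<forall>x\<in>set rest. x \<le> n + 1" by (auto simp: rest_def)
    have rep: "represents n {0} (\<lambda>_. 0) s \<sigma>"
      using small address_ge unfolding represents_def \<sigma>_def s_def
      by (auto simp: address_def)
    have "code_at P 2 (compile 2 signing_program)"
      using code_at_suffix[of "[SetConst 0 1, Read 1]" "compile 2 signing_program"]
      by (simp add: P_def numeral_2_eq_2)
    from compile_correct[OF this wf_signing_program _ rep]
    obtain \<sigma>' where \<sigma>': "run_within P \<sigma> (time_bound n signing_program) \<sigma>'"
      "pc \<sigma>' = 2 + length (compile 2 signing_program)"
      "represents n {0} (\<lambda>_. 0) (sem n signing_program (\<lambda>_. 0) s) \<sigma>'"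
      by (auto simp: \<sigma>_def)
    have "1 + (int_size (int n) + 0) + time_bound n signing_program
      \<le> poly p (input_size (encode_graph n E))"
      using int_size_le_input_size[of n E] poly_nat_mono[OF size_le_input_size[of n E], of q]
      by (simp add: p_def q)
    with run_within_trans[OF start \<sigma>'(1)]
    have "run_within P (init_config (encode_graph n E)) (poly p (input_size (encode_graph n E))) \<sigma>'"
      by (rule run_within_mono)
    moreover have "length P \<le> pc \<sigma>'" "outp \<sigma>' = ys"
      using \<sigma>'(2,3) by (simp_all add: P_def ys_def represents_def)
    ultimately have "outputs_in_time P (encode_graph n E) ys (poly p (input_size (encode_graph n E)))"
      unfolding outputs_in_time_def run_within_def by blast
    moreover have "if \<exists>s. singular_signing n E s
       then \<exists>s. singular_signing n E s \<and> ys = 1 # encode_mat s else ys = [0]"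
      unfolding ys_def by (rule signing_program_correct[OF bip]) (simp_all add: s_def rest_def)
    ultimately show "\<exists>ys. outputs_in_time P (encode_graph n E) ys (poly p (input_size (encode_graph n E))) \<and>
      (if \<exists>s. singular_signing n E s
       then \<exists>s. singular_signing n E s \<and> ys = 1 # encode_mat s
       else ys = [0])"
      by blast
  qed
qed

end
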